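(* Let $G$ be a locally compact (Hausdorff) abelian group. If $m_{\phi}:L^1(G)\to\mathbb{C}$ is given by $$m_{\phi}(f) := \int_G f(x)\phi(x)\,dx$$ for some $\phi\in\mathcal{COS}(G)$, then $m_\phi\in\Delta(L^1(G),\star_c)$. Furthermore, for every $m\in\Delta(L^1(G),\star_c)$ there exists a unique $\phi\in\mathcal{COS}(G)$ such that $m=m_\phi$.
   Context: $G$ is written additively, with Haar measure used in all integrals; $L^1(G)$ is the space of complex-valued integrable functions on $G$ (modulo a.e. equality). The cosine convolution of $f,g\in L^1(G)$ is $$f\star_c g(x) := \int_G f(y)\cdot\frac{g(x+y)+g(x-y)}{2}\,dy,$$ which is finite for almost every $x\in G$ and makes $L^1(G)$ a (not necessarily commutative) Banach algebra. $\Delta(L^1(G),\star_c)$ denotes the set of all nonzero continuous $\mathbb{C}$-linear maps $m:L^1(G)\to\mathbb{C}$ which are multiplicative: $m(f\star_c g)=m(f)m(g)$ for all $f,g\in L^1(G)$. With $C^b(G)$ the space of bounded continuous functions $G\to\mathbb{C}$, the cosine class is $$\mathcal{COS}(G) := \left\{\phi\in C^b(G) : \phi\neq 0,\ \forall_{x,y\in G}\ \phi(x)\phi(y)=\frac{\phi(x+y)+\phi(x-y)}{2}\right\}.$$ *)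

theory Defs
  imports "HOL-Analysis.Analysis"
begin

text \<open>
  A Haar measure is a nonzero translation-invariant Radon measure on the Borel sets, where
  ``Radon'' means: finite on compact sets, outer regular on all Borel sets, and inner regular
  on open sets. No countability assumption on the group is made.
\<close>

definition haar_measure :: "'a::{topological_ab_group_add,t2_space} measure \<Rightarrow> bool" where
  "haar_measure M \<longleftrightarrow>
     sets M = sets borel \<and>
     emeasure M UNIV \<noteq> 0 \<and>
     (\<forall>K. compact K \<longrightarrow> emeasure M K < \<infinity>) \<and>
     (\<forall>B\<in>sets borel. emeasure M B = (INF U\<in>{U. open U \<and> B \<subseteq> U}. emeasure M U)) \<and>
     (\<forall>U. open U \<longrightarrow> emeasure M U = (SUP K\<in>{K. compact K \<and> K \<subseteq> U}. emeasure M K)) \<and>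
     (\<forall>a. \<forall>B\<in>sets borel. emeasure M ((\<lambda>x. a + x) ` B) = emeasure M B)"

definition ae_rel :: "'a measure \<Rightarrow> (('a \<Rightarrow> complex) \<times> ('a \<Rightarrow> complex)) set" where
  "ae_rel M = {(f, g). integrable M f \<and> integrable M g \<and> (AE x in M. f x = g x)}"

definition L1 :: "'a measure \<Rightarrow> ('a \<Rightarrow> complex) set set" where
  "L1 M = {f. integrable M f} // ae_rel M"

definition L1_class :: "'a measure \<Rightarrow> ('a \<Rightarrow> complex) \<Rightarrow> ('a \<Rightarrow> complex) set" where
  "L1_class M f = ae_rel M `` {f}"

text \<open>
  At the null set of points where the integrand is not integrable, the library's integral
  returns 0; this does not affect the class of the convolution in \<^const>\<open>L1\<close>.
\<close>

definition cos_conv ::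
  "'a::ab_group_add measure \<Rightarrow> ('a \<Rightarrow> complex) \<Rightarrow> ('a \<Rightarrow> complex) \<Rightarrow> 'a \<Rightarrow> complex" where
  "cos_conv M f g x = (LINT y|M. f y * ((g (x + y) + g (x - y)) / 2))"

text \<open>
  Functionals on \<^term>\<open>L1 M\<close> are represented by functions on equivalence classes with the
  value \<^const>\<open>undefined\<close> outside \<^term>\<open>L1 M\<close>, so that equality of functionals is equality
  in HOL. Their defining conditions are stated on representatives; continuity is the
  epsilon-delta condition for the \<^term>\<open>L1 M\<close> norm.
\<close>

definition Delta :: "'a::ab_group_add measure \<Rightarrow> (('a \<Rightarrow> complex) set \<Rightarrow> complex) set" where
  "Delta M = {m \<in> extensional (L1 M).
     (\<exists>F\<in>L1 M. m F \<noteq> 0) \<and>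
     (\<forall>f g. integrable M f \<longrightarrow> integrable M g \<longrightarrow>
        m (L1_class M (\<lambda>x. f x + g x)) = m (L1_class M f) + m (L1_class M g)) \<and>
     (\<forall>c f. integrable M f \<longrightarrow> m (L1_class M (\<lambda>x. c * f x)) = c * m (L1_class M f)) \<and>
     (\<forall>f. integrable M f \<longrightarrow> (\<forall>e>0. \<exists>d>0. \<forall>g. integrable M g \<longrightarrow>
        (LINT x|M. norm (g x - f x)) < d \<longrightarrow> dist (m (L1_class M g)) (m (L1_class M f)) < e)) \<and>
     (\<forall>f g. integrable M f \<longrightarrow> integrable M g \<longrightarrow>
        m (L1_class M (cos_conv M f g)) = m (L1_class M f) * m (L1_class M g))}"

definition COS :: "('a::{topological_ab_group_add,t2_space} \<Rightarrow> complex) set" where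
  "COS = {\<phi> \<in> bcontfun. \<phi> \<noteq> (\<lambda>_. 0) \<and>
     (\<forall>x y. \<phi> x * \<phi> y = (\<phi> (x + y) + \<phi> (x - y)) / 2)}"

text \<open>
  The integral does not depend on the representative, so the image of a class below is a
  singleton; see the lemma that follows.
\<close>

definition m_fun ::
  "'a measure \<Rightarrow> ('a \<Rightarrow> complex) \<Rightarrow> ('a \<Rightarrow> complex) set \<Rightarrow> complex" where
  "m_fun M \<phi> = restrict (\<lambda>F. the_elem ((\<lambda>f. LINT x|M. f x * \<phi> x) ` F)) (L1 M)"

lemma m_fun_L1_class:
  assumes "haar_measure M" "\<phi> \<in> COS" "integrable M f"
  shows "m_fun M \<phi> (L1_class M f) = (LINT x|M. f x * \<phi> x)"
proof -
  have "continuous_on UNIV \<phi>"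
    using assms(2) by (simp add: COS_def bcontfun_def)
  moreover have sets: "sets M = sets borel"
    using assms(1) by (simp add: haar_measure_def)
  ultimately have meas [measurable]: "\<phi> \<in> borel_measurable M"
    by (metis borel_measurable_continuous_onI measurable_cong_sets)
  have eq: "(LINT x|M. g x * \<phi> x) = (LINT x|M. f x * \<phi> x)" if "g \<in> L1_class M f" for g
  proof -
    have [measurable]: "g \<in> borel_measurable M" "f \<in> borel_measurable M"
      using that assms(3) by (auto simp: L1_class_def ae_rel_def)
    have "AE x in M. f x = g x"
      using that by (auto simp: L1_class_def ae_rel_def)
    then show ?thesis
      by (intro integral_cong_AE) auto
  qed
  have "f \<in> L1_class M f"
    using assms(3) by (simp add: L1_class_def ae_rel_def)
  with eq have "(\<lambda>g. LINT x|M. g x * \<phi> x) ` L1_class M f = {LINT x|M. f x * \<phi> x}"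
    by blast
  moreover have "L1_class M f \<in> L1 M"
    using assms(3) by (auto simp: L1_def L1_class_def intro: quotientI)
  ultimately show ?thesis
    by (simp add: m_fun_def)
qed

end

theory Submission
  imports Defs
begin

text \<open>
  That every \<open>\<phi>\<close> in the cosine class gives a character is Fubini's theorem: integrating
  \<open>f y * (g (x + y) + g (x - y)) / 2 * \<phi> x\<close> first over \<open>x\<close> and translating turns
  \<open>\<phi> x\<close> into the mean of \<open>\<phi> (x - y)\<close> and \<open>\<phi> (x + y)\<close>, which is \<open>\<phi> x * \<phi> y\<close>.

  For the converse, let \<open>T\<close> be a character and \<open>\<tau>\<^sub>y g\<close> the cosine translate
  \<open>x \<mapsto> (g (x + y) + g (x - y)) / 2\<close>. The cosine convolution of \<open>f\<close> and \<open>g\<close> is the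
  integral of \<open>f y * \<tau>\<^sub>y g\<close> over \<open>y\<close>, taken in the space of integrable functions, and a
  continuous linear functional commutes with it:
  \<open>T (f \<star> g) = \<integral> f y * T (\<tau>\<^sub>y g) dy\<close> (lemma \<open>T_cos_conv\<close>). If \<open>T g \<noteq> 0\<close>, then
  multiplicativity says that \<open>T\<close> is integration against \<open>\<phi> y = T (\<tau>\<^sub>y g) / T g\<close>, which is
  continuous and bounded because translation is continuous in the \<open>L\<^sup>1\<close> norm. Applied to any
  \<open>f\<close> in place of \<open>g\<close>, the same formula shows that \<open>T (\<tau>\<^sub>y f) - \<phi> y * T f\<close> is annihilated
  by all integrable functions of \<open>y\<close>, so \<open>T (\<tau>\<^sub>y f) = \<phi> y * T f\<close>; with
  \<open>\<tau>\<^sub>x (\<tau>\<^sub>y g) = (\<tau>\<^bsub>x+y\<^esub> g + \<tau>\<^bsub>x-y\<^esub> g) / 2\<close> this is the cosine equation for \<open>\<phi>\<close>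
  (lemma \<open>COS_representation\<close>). Uniqueness holds because a continuous function that
  annihilates all integrable functions vanishes.

  The technical difficulty is Fubini's theorem itself. The Haar measure need not be
  \<open>\<sigma>\<close>-finite, and addition need not be measurable for the product of the two Borel
  \<open>\<sigma>\<close>-algebras when the topology has no countable base. Two reductions deal with this.
  Any integrable function equals almost everywhere a limit of continuous functions with compact
  supports, all inside a \<open>\<sigma>\<close>-compact subgroup \<open>H\<close>, and the measure restricted to \<open>H\<close> is
  \<open>\<sigma>\<close>-finite. For \<open>h\<close> continuous with compact support, \<open>h (x + y)\<close> is uniformly continuous
  in \<open>y\<close>, so on \<open>y \<in> H\<close> it is a limit of functions that are piecewise of the form
  \<open>h (x + a)\<close>, and these are measurable for the product \<open>\<sigma>\<close>-algebra. Passing to such a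
  representative of \<open>g\<close> leaves the convolution unchanged at every point, because reflection
  preserves null sets; that is the classical uniqueness argument for Haar measure, specialised
  to the reflected measure.
\<close>

section \<open>Haar measure, translations and nonempty open sets\<close>

locale haar_lca =
  fixes M :: "'a::{topological_ab_group_add,t2_space} measure"
  assumes lc: "locally_compact_space (euclidean :: 'a topology)"
    and haar: "haar_measure M"
begin

lemma sets_M [measurable_cong]: "sets M = sets borel"
  using haar by (simp add: haar_measure_def)

lemma space_M [simp]: "space M = UNIV"
  using sets_eq_imp_space_eq[OF sets_M] by simp

lemma integrable_borel: "integrable M g \<Longrightarrow> g \<in> borel_measurable borel"
  using borel_measurable_integrable[of M g] by (simp add: measurable_cong_sets[OF sets_M])

lemma outer_regular:
  "B \<in> sets borel \<Longrightarrow> emeasure M B = (INF U\<in>{U. open U \<and> B \<subseteq> U}. emeasure M U)"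
  using haar unfolding haar_measure_def by blast

lemma inner_regular_open:
  "open U \<Longrightarrow> emeasure M U = (SUP K\<in>{K. compact K \<and> K \<subseteq> U}. emeasure M K)"
  using haar unfolding haar_measure_def by blast

lemma emeasure_compact_finite: "compact K \<Longrightarrow> emeasure M K < \<infinity>"
  using haar by (simp add: haar_measure_def)

lemma borel_translate [measurable]: "(\<lambda>x::'a. x + a) \<in> borel_measurable borel"
  by (intro borel_measurable_continuous_onI continuous_intros)

lemma borel_translate_left [measurable]: "(\<lambda>x::'a. a + x) \<in> borel_measurable borel"
  by (intro borel_measurable_continuous_onI continuous_intros)

lemma borel_translate_diff [measurable]: "(\<lambda>x::'a. x - a) \<in> borel_measurable borel"
  by (intro borel_measurable_continuous_onI continuous_intros)

lemma borel_reflect [measurable]: "(\<lambda>x::'a. a - x) \<in> borel_measurable borel"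
  by (intro borel_measurable_continuous_onI continuous_intros)

lemma borel_uminus [measurable]: "(\<lambda>x::'a. - x) \<in> borel_measurable borel"
  by (intro borel_measurable_continuous_onI continuous_intros)

lemma distr_translate: "distr M borel (\<lambda>x. x + a) = M"
proof (rule measure_eqI)
  show "sets (distr M borel (\<lambda>x. x + a)) = sets M" by (simp add: sets_M)
  fix B assume "B \<in> sets (distr M borel (\<lambda>x. x + a))"
  then have B: "B \<in> sets borel" by simp
  have "(\<lambda>x. x + a) -` B = (\<lambda>x. (- a) + x) ` B"
    by (force simp: image_iff algebra_simps)
  moreover have "emeasure M ((\<lambda>x. (- a) + x) ` B) = emeasure M B"
    using haar B unfolding haar_measure_def by blast
  ultimately show "emeasure (distr M borel (\<lambda>x. x + a)) B = emeasure M B"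
    using B by (subst emeasure_distr) auto
qed

lemma nn_integral_translate:
  assumes [measurable]: "f \<in> borel_measurable borel"
  shows "(\<integral>\<^sup>+x. f (x + a) \<partial>M) = (\<integral>\<^sup>+x. f x \<partial>M)"
  using nn_integral_distr[of "\<lambda>x. x + a" M borel f] by (simp add: distr_translate)

lemma integrable_translate:
  fixes f :: "'a \<Rightarrow> complex"
  assumes "integrable M f"
  shows "integrable M (\<lambda>x. f (x + a))"
proof -
  have "f \<in> borel_measurable borel"
    using borel_measurable_integrable[OF assms] by (simp add: measurable_cong_sets[OF sets_M])
  then show ?thesis
    using assms integrable_distr_eq[of "\<lambda>x. x + a" M borel f] by (simp add: distr_translate)
qed

lemma integral_translate:
  fixes f :: "'a \<Rightarrow> 'b::{banach, second_countable_topology}"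
  assumes [measurable]: "f \<in> borel_measurable borel"
  shows "(LINT x|M. f (x + a)) = (LINT x|M. f x)"
  using integral_distr[of "\<lambda>x. x + a" M borel f] by (simp add: distr_translate)

lemma AE_translate:
  assumes "AE x in M. P x"
  shows "AE x in M. P (x + a)"
proof -
  have "AE x in distr M borel (\<lambda>x. x + a). P x"
    using assms by (subst distr_translate)
  from AE_distrD[OF _ this] show ?thesis by simp
qed

text \<open>
  Finitely many translates of a nonempty open set cover a given compact set, so a null open set
  would make all compact sets null, and then the whole group by inner regularity.
\<close>

lemma emeasure_open_pos:
  assumes "open U" "U \<noteq> {}"
  shows "emeasure M U > 0"
proof (rule ccontr)
  assume "\<not> ?thesis"
  then have U0: "emeasure M U = 0" by (simp add: not_gr_zero)
  obtain u where u: "u \<in> U" using assms by auto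
  have *: "open ((\<lambda>x. x + a) -` U)" for a
    using assms(1) by (intro open_vimage continuous_intros)
  have null: "(\<lambda>x. x + a) -` U \<in> null_sets M" for a
  proof -
    have "emeasure M ((\<lambda>x. x + a) -` U) = emeasure (distr M borel (\<lambda>x. x + a)) U"
      using assms(1) by (subst emeasure_distr) auto
    then show ?thesis using * U0 by (auto simp: null_sets_def distr_translate sets_M)
  qed
  have "emeasure M K = 0" if K: "compact K" for K
  proof -
    have "K \<subseteq> (\<Union>a\<in>UNIV. (\<lambda>x. x + a) -` U)"
    proof
      fix x show "x \<in> (\<Union>a\<in>UNIV. (\<lambda>x. x + a) -` U)"
        using u by (auto intro!: exI[of _ "u - x"])
    qed
    then obtain F where F: "finite F" "K \<subseteq> (\<Union>a\<in>F. (\<lambda>x. x + a) -` U)"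
      using compactE_image[OF K, of UNIV "\<lambda>a. (\<lambda>x. x + a) -` U"] * by metis
    have "(\<Union>a\<in>F. (\<lambda>x. x + a) -` U) \<in> null_sets M"
      using F(1) null by auto
    then show ?thesis using F(2)
      by (metis emeasure_mono le_zero_eq null_setsD1 null_setsD2)
  qed
  then have "emeasure M UNIV = 0"
    using inner_regular_open[of UNIV] by (auto intro!: SUP_eq_const)
  then show False using haar by (simp add: haar_measure_def)
qed

section \<open>Continuous functions with compact support\<close>

lemma Hausdorff_euclidean: "Hausdorff_space (euclidean :: 'a topology)"
  unfolding Hausdorff_space_def by (auto simp: disjnt_def dest!: hausdorff)

lemma compact_neighbourhood:
  assumes "compact (K::'a set)"
  obtains U L where "open U" "compact L" "K \<subseteq> U" "U \<subseteq> L"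
proof -
  have "\<exists>U L. openin euclidean U \<and> compactin euclidean L \<and> closedin euclidean L \<and> K \<subseteq> U \<and> U \<subseteq> L"
    using locally_compact_space_compact_closed_compact[of "euclidean :: 'a topology"]
      Hausdorff_euclidean lc assms by auto
  then show ?thesis using that by auto
qed

definition Cc :: "('a \<Rightarrow> complex) set" where
  "Cc = {h. continuous_on UNIV h \<and> (\<exists>K. compact K \<and> (\<forall>x. x \<notin> K \<longrightarrow> h x = 0))}"

lemma Cc_bump:
  assumes "compact K" "open U" "K \<subseteq> U"
  obtains h :: "'a \<Rightarrow> real" where "(\<lambda>x. complex_of_real (h x)) \<in> Cc"
    "\<And>x. indicator K x \<le> h x" "\<And>x. h x \<le> indicator U x"
proof -
  obtain V L where VL: "open V" "compact L" "K \<subseteq> V" "V \<subseteq> L"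
    using compact_neighbourhood[OF assms(1)] .
  have cr: "completely_regular_space (euclidean :: 'a topology)"
    using locally_compact_regular_imp_completely_regular_space lc Hausdorff_euclidean by blast
  obtain f where f: "continuous_map euclidean (subtopology euclidean {0..1::real}) f"
    "f ` (- (U \<inter> V)) \<subseteq> {0}" "f ` K \<subseteq> {1}"
  proof (rule Urysohn_completely_regular_compact_closed[OF _ cr, of 0 1])
    show "compactin euclidean K" using assms by simp
    show "closedin euclidean (- (U \<inter> V))" using assms VL by (auto intro: open_Int)
    show "disjnt K (- (U \<inter> V))" using assms VL by (auto simp: disjnt_def)
  qed auto
  have cont: "continuous_on UNIV f" and rng: "\<And>x. f x \<in> {0..1}"
    using f(1) by (auto simp: continuous_map_in_subtopology)
  have "(\<lambda>x. complex_of_real (f x)) \<in> Cc"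
    unfolding Cc_def using cont f(2) VL
    by (auto intro!: continuous_intros exI[of _ L] simp: image_subset_iff)
  moreover have "indicator K x \<le> f x" for x
    using rng[of x] f(3) by (auto simp: indicator_def)
  moreover have "f x \<le> indicator U x" for x
    using rng[of x] f(2) by (auto simp: indicator_def)
  ultimately show ?thesis using that by blast
qed

lemma Cc_borel: "h \<in> Cc \<Longrightarrow> h \<in> borel_measurable borel"
  by (auto simp: Cc_def intro: borel_measurable_continuous_onI)

lemma Cc_bounded:
  assumes "h \<in> Cc" obtains B where "B > 0" "\<And>x. norm (h x) \<le> B"
proof -
  obtain K where K: "compact K" "\<And>x. x \<notin> K \<Longrightarrow> h x = 0" and c: "continuous_on UNIV h"
    using assms by (auto simp: Cc_def)
  have "compact (h ` K)"
    using K c by (intro compact_continuous_image) (auto intro: continuous_on_subset)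
  then obtain B where B: "B > 0" "\<And>x. x \<in> K \<Longrightarrow> norm (h x) \<le> B"
    using compact_imp_bounded bounded_pos by (metis imageI)
  have "norm (h x) \<le> B" for x using B K by (cases "x \<in> K") auto
  then show ?thesis using that B by blast
qed

lemma integrable_indicator_compact:
  "compact K \<Longrightarrow> integrable M (\<lambda>x. indicator K x :: real)"
  using emeasure_compact_finite[of K]
  by (intro integrable_real_indicator) (auto simp: sets_M compact_imp_closed)

lemma Cc_integrable:
  assumes "h \<in> Cc" shows "integrable M h"
proof -
  obtain K where K: "compact K" "\<And>x. x \<notin> K \<Longrightarrow> h x = 0"
    using assms by (auto simp: Cc_def)
  obtain B where B: "B > 0" "\<And>x. norm (h x) \<le> B" using Cc_bounded[OF assms] by blast
  have "integrable M (\<lambda>x. B * indicator K x)"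
    using integrable_indicator_compact[OF K(1)] by simp
  moreover have "h \<in> borel_measurable M" using Cc_borel[OF assms] by (simp cong: measurable_cong_sets add: sets_M)
  moreover have "AE x in M. norm (h x) \<le> norm (B * indicator K x)"
    using B K by (auto simp: indicator_def intro!: AE_I2)
  ultimately show ?thesis by (rule Bochner_Integration.integrable_bound)
qed

lemma Cc_add:
  assumes "f \<in> Cc" "g \<in> Cc"
  shows "(\<lambda>x. f x + g x) \<in> Cc"
proof -
  obtain K L where c: "continuous_on UNIV f" "continuous_on UNIV g" "compact K" "compact L"
    and z: "\<forall>x. x \<notin> K \<longrightarrow> f x = 0" "\<forall>x. x \<notin> L \<longrightarrow> g x = 0"
    using assms unfolding Cc_def by blast
  have "continuous_on UNIV (\<lambda>x. f x + g x)" using c by (intro continuous_intros)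
  moreover have "\<exists>M. compact M \<and> (\<forall>x. x \<notin> M \<longrightarrow> f x + g x = 0)"
    using c z by (intro exI[of _ "K \<union> L"]) auto
  ultimately show ?thesis by (simp add: Cc_def)
qed

lemma Cc_cmult: "f \<in> Cc \<Longrightarrow> (\<lambda>x. c * f x) \<in> Cc"
  unfolding Cc_def by (auto intro!: continuous_intros)

text \<open>
  Outer regularity gives an open \<open>U \<supseteq> A\<close> and inner regularity of \<open>U\<close> a compact
  \<open>K \<subseteq> U\<close>, both close to \<open>A\<close> in measure. A bump function \<open>h\<close> between them differs from
  the indicator of \<open>A\<close> only on \<open>U - A\<close> and \<open>U - K\<close>, so \<open>K\<close> may stick out of \<open>A\<close>.
\<close>

lemma indicator_approx_Cc:
  assumes A: "A \<in> sets M" "emeasure M A < \<infinity>" and e: "e > 0"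
  shows "\<exists>h\<in>Cc. (LINT x|M. norm (indicator A x - h x)) < e"
proof -
  have A': "A \<in> sets borel" using A sets_M by simp
  define a where "a = measure M A"
  have ea: "emeasure M A = ennreal a" using A(2) by (simp add: a_def emeasure_eq_ennreal_measure)
  have "(INF U\<in>{U. open U \<and> A \<subseteq> U}. emeasure M U) < emeasure M A + ennreal (e/3)"
    unfolding outer_regular[OF A', symmetric] using e by (simp add: ea a_def ennreal_plus[symmetric] ennreal_less_iff del: ennreal_plus)
  then obtain U where U: "open U" "A \<subseteq> U" "emeasure M U < emeasure M A + ennreal (e/3)"
    by (auto simp: Inf_less_iff)
  have Ufin: "emeasure M U < \<infinity>"
    using U(3) by (simp add: ea) (metis ennreal_add_eq_top ennreal_neq_top less_top_ennreal order_less_trans top.not_eq_extremum ennreal_less_top)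
  have eU: "emeasure M U = ennreal (measure M U)" using Ufin by (simp add: emeasure_eq_ennreal_measure)
  have mU: "measure M U < a + e/3"
    using U(3) e by (simp add: ea eU a_def ennreal_plus[symmetric] ennreal_less_iff del: ennreal_plus)
  have "\<exists>K\<in>{K. compact K \<and> K \<subseteq> U}. emeasure M U < emeasure M K + ennreal (e/3)"
  proof (cases "emeasure M U < ennreal (e/3)")
    case True then show ?thesis by (intro bexI[of _ "{}"]) auto
  next
    case False
    have "emeasure M U - ennreal (e/3) < emeasure M U"
      using False e by (simp add: eU ennreal_minus ennreal_less_iff)
    then obtain K where K: "K\<in>{K. compact K \<and> K \<subseteq> U}" "emeasure M U - ennreal (e/3) < emeasure M K"
      by (subst (asm) (2) inner_regular_open[OF U(1)]) (auto simp: less_SUP_iff)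
    then have eK: "emeasure M K = ennreal (measure M K)"
      using emeasure_compact_finite[of K] by (simp add: emeasure_eq_ennreal_measure)
    have "ennreal (measure M U - e/3) < ennreal (measure M K)"
      using K(2) e by (simp add: eU eK ennreal_minus)
    then have "measure M U - e/3 < measure M K"
      by (metis ennreal_leI linorder_not_le)
    then show ?thesis using e K(1)
      by (intro bexI[of _ K])
        (auto simp: eU eK ennreal_plus[symmetric] ennreal_less_iff simp del: ennreal_plus)
  qed
  then obtain K where K: "compact K" "K \<subseteq> U" "emeasure M U < emeasure M K + ennreal (e/3)" by auto
  have mK: "measure M U < measure M K + e/3"
    using K(3) e emeasure_compact_finite[OF K(1)]
    by (simp add: eU emeasure_eq_ennreal_measure ennreal_plus[symmetric] ennreal_less_iff del: ennreal_plus)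
  obtain h :: "'a \<Rightarrow> real" where h: "(\<lambda>x. complex_of_real (h x)) \<in> Cc"
    "\<And>x. indicator K x \<le> h x" "\<And>x. h x \<le> indicator U x" using Cc_bump[OF K(1) U(1) K(2)] by blast
  have sK: "K \<in> sets M" "U \<in> sets M" using K U by (auto simp: sets_M compact_imp_closed)
  have fm: "U \<in> fmeasurable M" "K \<in> fmeasurable M" "A \<in> fmeasurable M"
    using sK A Ufin emeasure_compact_finite[OF K(1)] by (auto simp: fmeasurable_def)
  note ind = integrable_real_indicator
  have bnd: "norm (indicator A x - complex_of_real (h x)) \<le> 2 * indicator U x - indicator A x - indicator K x" for x
  proof -
    have "norm (indicator A x - complex_of_real (h x)) = \<bar>indicator A x - h x\<bar>"
      by (metis norm_of_real of_real_diff of_real_indicator)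
    then show ?thesis using h(2,3)[of x] U(2) K(2) by (auto simp: indicator_def split: if_splits)
  qed
  have iA: "integrable M (\<lambda>x. indicator A x :: real)" and iU: "integrable M (\<lambda>x. indicator U x :: real)"
    and iK: "integrable M (\<lambda>x. indicator K x :: real)"
    using sK A Ufin emeasure_compact_finite[OF K(1)] by (auto intro!: integrable_real_indicator)
  have "(LINT x|M. norm (indicator A x - complex_of_real (h x)))
    \<le> (LINT x|M. 2 * indicator U x - indicator A x - indicator K x)"
  proof (rule integral_mono)
    have "integrable M (\<lambda>x. complex_of_real (indicator A x))"
      using iA by (rule integrable_of_real)
    then show "integrable M (\<lambda>x. norm (indicator A x - complex_of_real (h x)))"
      using Cc_integrable[OF h(1)] by (intro integrable_norm Bochner_Integration.integrable_diff) (simp_all add: of_real_indicator)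
  qed (use iA iU iK bnd in auto)
  also have "\<dots> = 2 * measure M U - a - measure M K"
    using iA iU iK sK A by (simp add: a_def)
  also have "\<dots> < e" using mU mK e by simp
  finally have "(LINT x|M. norm (indicator A x - complex_of_real (h x))) < e" .
  then show ?thesis
    by (rule bexI[where x="\<lambda>x. complex_of_real (h x)"]) (rule h(1))
qed

lemma Cc_dense:
  assumes "integrable M f" "e > 0"
  shows "\<exists>h\<in>Cc. (LINT x|M. norm (f x - h x)) < e"
  using assms
proof (induction f arbitrary: e rule: integrable_induct)
  case (base A c)
  show ?case
  proof (cases "c = 0")
    case True
    have "(\<lambda>_. 0) \<in> Cc" unfolding Cc_def by (auto intro!: exI[of _ "{}"])
    then show ?thesis using True base by (intro bexI[of _ "\<lambda>_. 0"]) auto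
  next
    case False
    obtain h where h: "h \<in> Cc" "(LINT x|M. norm (indicator A x - h x)) < e / norm c"
      using indicator_approx_Cc[OF base(1,2), of "e / norm c"] base False by auto
    have "(LINT x|M. norm (indicator A x *\<^sub>R c - c * h x)) = (LINT x|M. norm c * norm (indicator A x - h x))"
    proof (intro Bochner_Integration.integral_cong refl)
      fix x show "norm (indicator A x *\<^sub>R c - c * h x) = norm c * norm (indicator A x - h x)"
        unfolding norm_mult[symmetric] by (simp add: indicator_def algebra_simps)
    qed
    also have "\<dots> < e" using h(2) False by (simp add: field_simps)
    finally show ?thesis using Cc_cmult[OF h(1), of c] by (intro bexI[of _ "\<lambda>x. c * h x"])
  qed
next
  case (add f g)
  obtain h k where h: "h \<in> Cc" "(LINT x|M. norm (f x - h x)) < e/2"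
    and k: "k \<in> Cc" "(LINT x|M. norm (g x - k x)) < e/2"
    using add.IH[of "e/2"] add.prems by auto
  have i: "integrable M (\<lambda>x. norm (f x - h x))" "integrable M (\<lambda>x. norm (g x - k x))"
    using add.hyps Cc_integrable[OF h(1)] Cc_integrable[OF k(1)] by auto
  have "(LINT x|M. norm (f x + g x - (h x + k x))) \<le> (LINT x|M. norm (f x - h x) + norm (g x - k x))"
  proof (rule integral_mono)
    show "integrable M (\<lambda>x. norm (f x + g x - (h x + k x)))"
      using add.hyps Cc_integrable[OF h(1)] Cc_integrable[OF k(1)] by auto
    show "norm (f x + g x - (h x + k x)) \<le> norm (f x - h x) + norm (g x - k x)" for x
      by (metis add_diff_add norm_triangle_ineq)
  qed (use i in auto)
  also have "\<dots> < e" using i h k by simp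
  finally show ?case using Cc_add[OF h(1) k(1)] by (intro bexI[of _ "\<lambda>x. h x + k x"])
next
  case (lim f s)
  have "(\<lambda>i. LINT x|M. norm (s i x - f x)) \<longlonglongrightarrow> (LINT x|M. 0)"
  proof (rule integral_dominated_convergence[where w="\<lambda>x. 3 * norm (f x)"])
    show "AE x in M. (\<lambda>i. norm (s i x - f x)) \<longlonglongrightarrow> 0"
      using lim.hyps(2) by (auto intro!: AE_I2 tendsto_norm_zero simp: LIM_zero)
    show "AE x in M. norm (norm (s i x - f x)) \<le> 3 * norm (f x)" for i
    proof (rule AE_I2)
      fix x assume "x \<in> space M"
      then show "norm (norm (s i x - f x)) \<le> 3 * norm (f x)"
        using lim.hyps(3)[of x i] norm_triangle_ineq4[of "s i x" "f x"] by simp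
    qed
  qed (use lim.hyps in auto)
  then have "eventually (\<lambda>i. (LINT x|M. norm (s i x - f x)) < e/2) sequentially"
    using lim.prems by (intro order_tendstoD) auto
  then obtain i where i: "(LINT x|M. norm (s i x - f x)) < e/2" by (auto simp: eventually_sequentially)
  obtain h where h: "h \<in> Cc" "(LINT x|M. norm (s i x - h x)) < e/2"
    using lim.IH[of "e/2" i] lim.prems by auto
  have ii: "integrable M (\<lambda>x. norm (s i x - f x))" "integrable M (\<lambda>x. norm (s i x - h x))"
    using lim.hyps Cc_integrable[OF h(1)] by auto
  have "(LINT x|M. norm (f x - h x)) \<le> (LINT x|M. norm (s i x - f x) + norm (s i x - h x))"
  proof (rule integral_mono)
    show "integrable M (\<lambda>x. norm (f x - h x))"
      using lim.hyps Cc_integrable[OF h(1)] by auto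
    show "norm (f x - h x) \<le> norm (s i x - f x) + norm (s i x - h x)" for x
      using norm_triangle_ineq4[of "s i x - h x" "s i x - f x"] by simp
  qed (use ii in auto)
  also have "\<dots> < e" using ii h i by simp
  finally show ?case using h(1) by blast
qed

lemma Cc_AE_limit:
  assumes "integrable M f"
  obtains h where "\<And>n::nat. h n \<in> Cc" "AE x in M. (\<lambda>n. h n x) \<longlonglongrightarrow> f x"
proof -
  have "\<exists>h. \<forall>n::nat. h n \<in> Cc \<and> (LINT x|M. norm (f x - h n x)) < 1 / Suc n"
    using Cc_dense[OF assms] by (intro choice) (auto simp: Bex_def)
  then obtain h where h: "\<And>n. h n \<in> Cc" "\<And>n. (LINT x|M. norm (f x - h n x)) < 1 / Suc n" by blast
  have "(\<lambda>n. LINT x|M. norm (f x - h n x)) \<longlonglongrightarrow> 0"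
  proof (rule tendsto_sandwich[OF _ _ tendsto_const LIMSEQ_inverse_real_of_nat])
    show "\<forall>\<^sub>F n in sequentially. (LINT x|M. norm (f x - h n x)) \<le> inverse (real (Suc n))"
      using h(2) by (auto intro!: always_eventually less_imp_le simp: inverse_eq_divide)
  qed auto
  then obtain r where "AE x in M. (\<lambda>n. f x - h (r n) x) \<longlonglongrightarrow> 0"
    using tendsto_L1_AE_subseq[of M "\<lambda>n x. f x - h n x"] assms Cc_integrable[OF h(1)] by auto
  then have "AE x in M. (\<lambda>n. h (r n) x) \<longlonglongrightarrow> f x"
  proof eventually_elim
    case (elim x)
    have "(\<lambda>n. f x - (f x - h (r n) x)) \<longlonglongrightarrow> f x - 0" using elim by (intro tendsto_intros)
    then show ?case by simp
  qed
  then show ?thesis using that[of "\<lambda>n. h (r n)"] h by blast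
qed

text \<open>
  By the tube lemma, \<open>h (x + u)\<close> is close to \<open>h x\<close> for all \<open>x\<close> in the support and all
  \<open>u\<close> in a neighbourhood of \<open>0\<close>. Making the neighbourhood symmetric covers the points \<open>x\<close>
  outside the support for which \<open>x + u\<close> lies inside it.
\<close>

lemma Cc_uniformly_continuous:
  assumes "h \<in> Cc" "e > 0"
  obtains U where "open U" "0 \<in> U" "\<And>x u. u \<in> U \<Longrightarrow> norm (h (x + u) - h x) < e"
proof -
  obtain K where K: "compact K" "\<And>x. x \<notin> K \<Longrightarrow> h x = 0" and c: "continuous_on UNIV h"
    using assms by (auto simp: Cc_def)
  define W where "W = {(u, x). norm (h (x + u) - h x) < e}"
  have W: "open W"
    unfolding W_def case_prod_unfold
    by (intro open_Collect_less continuous_intros continuous_on_compose2[OF c]) auto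
  have W0: "{0} \<times> K \<subseteq> W" using assms(2) by (auto simp: W_def)
  obtain V where V: "0 \<in> V" "open V" "V \<times> K \<subseteq> W"
    using Elementary_Topology.tube_lemma[OF K(1) W W0] by (elim exE conjE)
  have "open (V \<inter> uminus -` V)"
    using V by (intro open_Int open_vimage continuous_intros) auto
  moreover have "0 \<in> V \<inter> uminus -` V" using V by auto
  moreover have "norm (h (x + u) - h x) < e" if u: "u \<in> V \<inter> uminus -` V" for x u
  proof -
    consider "x \<in> K" | "x + u \<in> K" | "x \<notin> K" "x + u \<notin> K" by blast
    then show ?thesis
    proof cases
      case 2
      then have "(- u, x + u) \<in> W" using V u by auto
      then show ?thesis by (simp add: W_def norm_minus_commute)
    qed (use V u K assms(2) in \<open>auto simp: W_def\<close>)
  qed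
  ultimately show ?thesis using that by blast
qed

end

section \<open>Sigma-compact subgroups\<close>

definition sigma_compact_subgroup :: "'a::topological_ab_group_add set \<Rightarrow> bool" where
  "sigma_compact_subgroup H \<longleftrightarrow>
     (\<exists>B::nat \<Rightarrow> 'a set. (\<forall>n. compact (B n)) \<and> incseq B \<and> H = (\<Union>n. B n)) \<and>
     0 \<in> H \<and> (\<forall>x\<in>H. \<forall>y\<in>H. x - y \<in> H)"

text \<open>
  The sets \<open>B n\<close> are closed up step by step under differences while \<open>K n\<close> is thrown in;
  since \<open>0\<close> is included, they increase.
\<close>

lemma sigma_compact_subgroup_exists:
  fixes K :: "nat \<Rightarrow> 'a::{topological_ab_group_add,t2_space} set"
  assumes "\<And>n. compact (K n)"
  obtains H where "sigma_compact_subgroup H" "\<And>n. K n \<subseteq> H"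
proof -
  define D where "D = (\<lambda>A::'a set. (\<lambda>p. fst p - snd p) ` (A \<times> A))"
  define B where "B = rec_nat {0} (\<lambda>n A. D (A \<union> K n \<union> {0}))"
  have B0: "B 0 = {0}" and BS: "B (Suc n) = D (B n \<union> K n \<union> {0})" for n
    by (simp_all add: B_def)
  have D_compact: "compact (D A)" if "compact A" for A
    unfolding D_def using that
    by (intro compact_continuous_image compact_Times continuous_intros)
  have D_mono: "A \<subseteq> D A" if "0 \<in> A" for A
    using that by (force simp: D_def)
  have comp: "compact (B n)" for n
    by (induction n) (auto simp: B0 BS assms intro!: D_compact compact_insert)
  have step: "B n \<union> K n \<union> {0} \<subseteq> B (Suc n)" for n
    unfolding BS by (rule D_mono) simp
  have inc: "incseq B"
    using step by (intro incseq_SucI) blast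
  have "x - y \<in> (\<Union>n. B n)" if xy: "x \<in> (\<Union>n. B n)" "y \<in> (\<Union>n. B n)" for x y
  proof -
    obtain i j where "x \<in> B i" "y \<in> B j" using xy by blast
    then have "x \<in> B (max i j)" "y \<in> B (max i j)"
      using incseqD[OF inc] by (meson max.cobounded1 max.cobounded2 subsetD)+
    then have "x - y \<in> B (Suc (max i j))"
      unfolding BS D_def by force
    then show ?thesis by blast
  qed
  moreover have "0 \<in> (\<Union>n. B n)" using B0 by blast
  ultimately have "sigma_compact_subgroup (\<Union>n. B n)"
    unfolding sigma_compact_subgroup_def using comp inc by blast
  moreover have "K n \<subseteq> (\<Union>n. B n)" for n
    using step[of n] by blast
  ultimately show ?thesis using that by blast
qed

locale haar_lca_subgroup = haar_lca M for M :: "'a::{topological_ab_group_add,t2_space} measure" +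
  fixes H :: "'a set"
  assumes H: "sigma_compact_subgroup H"
begin

lemma H_zero: "0 \<in> H" and H_diff: "x \<in> H \<Longrightarrow> y \<in> H \<Longrightarrow> x - y \<in> H"
  using H by (auto simp: sigma_compact_subgroup_def)

lemma H_minus [simp]: "- x \<in> H \<longleftrightarrow> x \<in> H"
  using H_diff[OF H_zero, of x] H_diff[OF H_zero, of "- x"] by auto

lemma H_add: "x \<in> H \<Longrightarrow> y \<in> H \<Longrightarrow> x + y \<in> H"
  using H_diff[of x "- y"] by simp

lemma H_add_iff [simp]: "y \<in> H \<Longrightarrow> x + y \<in> H \<longleftrightarrow> x \<in> H"
  using H_add[of x y] H_diff[of "x + y" y] by auto

lemma H_diff_iff [simp]: "y \<in> H \<Longrightarrow> x - y \<in> H \<longleftrightarrow> x \<in> H"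
  using H_add_iff[of "- y" x] by simp

lemma H_exhaustion:
  obtains B :: "nat \<Rightarrow> 'a set" where "\<And>n. compact (B n)" "incseq B" "H = (\<Union>n. B n)"
  using H unfolding sigma_compact_subgroup_def by blast

lemma H_borel [measurable]: "H \<in> sets borel"
proof -
  obtain B :: "nat \<Rightarrow> 'a set" where "\<And>n. compact (B n)" "incseq B" "H = (\<Union>n. B n)"
    using H_exhaustion by blast
  moreover from this have "closed (B n)" for n by (intro compact_imp_closed)
  ultimately show ?thesis by auto
qed

text \<open>
  The restriction of the Haar measure to the subgroup, kept as a measure on the whole group. It
  is \<open>\<sigma>\<close>-finite and invariant under translations by elements of \<open>H\<close>, and it gives the
  same integral as the Haar measure to functions that vanish outside \<open>H\<close>.
\<close>

definition N :: "'a measure" where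
  "N = density M (indicator H)"

lemma sets_N [measurable_cong]: "sets N = sets borel"
  by (simp add: N_def sets_M)

lemma space_N [simp]: "space N = UNIV"
  by (simp add: N_def)

lemma nn_integral_N:
  assumes [measurable]: "f \<in> borel_measurable borel"
  shows "(\<integral>\<^sup>+x. f x \<partial>N) = (\<integral>\<^sup>+x. indicator H x * f x \<partial>M)"
  unfolding N_def by (rule nn_integral_density) measurable

lemma AE_N_H: "AE x in N. x \<in> H"
  unfolding N_def by (subst AE_density) (auto simp: indicator_def)

lemma integrable_N_iff:
  fixes f :: "'a \<Rightarrow> complex"
  assumes [measurable]: "f \<in> borel_measurable borel" and "\<And>x. x \<notin> H \<Longrightarrow> f x = 0"
  shows "integrable N f \<longleftrightarrow> integrable M f"
proof -
  have "(\<lambda>x. indicator H x *\<^sub>R f x) = f" using assms(2) by (auto simp: indicator_def)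
  moreover have "integrable (density M (\<lambda>x. ennreal (indicator H x))) f \<longleftrightarrow> integrable M (\<lambda>x. indicator H x *\<^sub>R f x)"
    by (rule integrable_density) auto
  ultimately show ?thesis by (simp add: N_def ennreal_indicator)
qed

lemma integral_N:
  fixes f :: "'a \<Rightarrow> 'b::{banach, second_countable_topology}"
  assumes [measurable]: "f \<in> borel_measurable borel" and "\<And>x. x \<notin> H \<Longrightarrow> f x = 0"
  shows "(LINT x|N. f x) = (LINT x|M. f x)"
proof -
  have "(\<lambda>x. indicator H x *\<^sub>R f x) = f" using assms(2) by (auto simp: indicator_def)
  moreover have "(LINT x|density M (\<lambda>x. ennreal (indicator H x)). f x) = (LINT x|M. indicator H x *\<^sub>R f x)"
    by (rule integral_density) auto
  ultimately show ?thesis by (simp add: N_def ennreal_indicator)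
qed

lemma sigma_finite_N: "sigma_finite_measure N"
proof
  obtain B :: "nat \<Rightarrow> 'a set" where B: "\<And>n. compact (B n)" "incseq B" "H = (\<Union>n. B n)"
    using H_exhaustion by blast
  have eN: "emeasure N A = emeasure M (H \<inter> A)" if "A \<in> sets borel" for A
    using that by (simp add: N_def emeasure_density sets_M nn_integral_indicator
        indicator_inter_arith[symmetric])
  have "emeasure N (B n) \<noteq> \<infinity>" for n
  proof -
    have "emeasure N (B n) \<le> emeasure M (B n)"
      using B(1) by (subst eN) (auto intro!: emeasure_mono simp: sets_M compact_imp_closed)
    then show ?thesis using emeasure_compact_finite[OF B(1), of n] by (simp add: top_unique less_top)
  qed
  moreover have "emeasure N (- H) = 0" by (subst eN) auto
  moreover have "(\<Union> (insert (- H) (range B))) = UNIV" using B(3) by blast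
  ultimately show "\<exists>A. countable A \<and> A \<subseteq> sets N \<and> \<Union> A = space N \<and> (\<forall>a\<in>A. emeasure N a \<noteq> \<infinity>)"
    using B(1) by (intro exI[of _ "insert (- H) (range B)"])
      (auto simp: sets_N compact_imp_closed)
qed

sublocale N: sigma_finite_measure N by (rule sigma_finite_N)
sublocale NN: pair_sigma_finite N N ..

lemma nn_integral_N_translate:
  assumes [measurable]: "f \<in> borel_measurable borel" and "y \<in> H"
  shows "(\<integral>\<^sup>+x. f (x + y) \<partial>N) = (\<integral>\<^sup>+x. f x \<partial>N)"
proof -
  have "(\<integral>\<^sup>+x. f (x + y) \<partial>N) = (\<integral>\<^sup>+x. indicator H (x + y) * f (x + y) \<partial>M)"
    using assms(2) by (subst nn_integral_N) (auto simp: indicator_def)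
  also have "\<dots> = (\<integral>\<^sup>+x. f x \<partial>N)"
    by (subst nn_integral_translate[where f="\<lambda>x. indicator H x * f x"]) (auto simp: nn_integral_N)
  finally show ?thesis .
qed

section \<open>Measurability of translates in both variables\<close>

text \<open>
  For \<open>y\<close> in \<open>a + U\<close>, with \<open>U\<close> a small neighbourhood of \<open>0\<close>, the value \<open>h (x + y)\<close> is
  uniformly close to \<open>h (x + a)\<close>, which does not depend on \<open>y\<close>. Finitely many such pieces
  cover \<open>K\<close>, which gives uniform approximations that are measurable for the product
  \<open>\<sigma>\<close>-algebra although addition itself need not be.
\<close>

lemma borel_pair_shift_Cc_compact:
  assumes h: "h \<in> Cc" and K: "compact K"
  shows "(\<lambda>p. indicator K (snd p) * h (fst p + snd p)) \<in> borel_measurable (borel \<Otimes>\<^sub>M borel)"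
proof -
  have Kb [measurable]: "K \<in> sets borel" using K by (simp add: compact_imp_closed)
  have hb [measurable]: "h \<in> borel_measurable borel" by (rule Cc_borel[OF h])
  have approx: "\<exists>q\<in>borel_measurable (borel \<Otimes>\<^sub>M borel). \<forall>x. \<forall>y\<in>K. norm (q (x, y) - h (x + y)) < e"
    if e: "e > 0" for e :: real
  proof -
    obtain U where U: "open U" "0 \<in> U" "\<And>x u. u \<in> U \<Longrightarrow> norm (h (x + u) - h x) < e"
      using Cc_uniformly_continuous[OF h e] by blast
    have oU: "open ((\<lambda>y. y - a) -` U)" for a
      using U(1) by (intro open_vimage continuous_intros)
    have "K \<subseteq> (\<Union>a\<in>UNIV. (\<lambda>y. y - a) -` U)"
    proof
      fix y show "y \<in> (\<Union>a\<in>UNIV. (\<lambda>y. y - a) -` U)"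
        using U(2) by (auto intro!: exI[of _ y])
    qed
    then obtain F where F: "finite F" "K \<subseteq> (\<Union>a\<in>F. (\<lambda>y. y - a) -` U)"
      using compactE_image[OF K, of UNIV "\<lambda>a. (\<lambda>y. y - a) -` U"] oU by metis
    have "\<exists>q\<in>borel_measurable (borel \<Otimes>\<^sub>M borel).
        \<forall>x. \<forall>y\<in>(\<Union>a\<in>F. (\<lambda>y. y - a) -` U). norm (q (x, y) - h (x + y)) < e"
      using F(1)
    proof induction
      case empty
      show ?case by (intro bexI[of _ "\<lambda>_. 0"]) auto
    next
      case (insert a F)
      then obtain q where [measurable]: "q \<in> borel_measurable (borel \<Otimes>\<^sub>M borel)"
        and q: "\<And>x y. y \<in> (\<Union>a\<in>F. (\<lambda>y. y - a) -` U) \<Longrightarrow> norm (q (x, y) - h (x + y)) < e"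
        by blast
      have [measurable]: "(\<lambda>y. y - a) -` U \<in> sets borel" using oU by simp
      define q' where "q' = (\<lambda>p. if snd p \<in> (\<lambda>y. y - a) -` U then h (fst p + a) else q p)"
      have "q' \<in> borel_measurable (borel \<Otimes>\<^sub>M borel)"
        unfolding q'_def by measurable
      moreover have "norm (q' (x, y) - h (x + y)) < e"
        if y: "y \<in> (\<Union>a\<in>insert a F. (\<lambda>y. y - a) -` U)" for x y
      proof (cases "y - a \<in> U")
        case True
        then show ?thesis using U(3)[OF True, of "x + a"]
          by (simp add: q'_def norm_minus_commute algebra_simps)
      next
        case False
        then show ?thesis using y q[of y x] by (auto simp: q'_def)
      qed
      ultimately show ?case by blast
    qed
    then show ?thesis using F(2) by blast
  qed
  have "\<forall>n. \<exists>q. q \<in> borel_measurable (borel \<Otimes>\<^sub>M borel) \<and> (\<forall>x. \<forall>y\<in>K. norm (q (x, y) - h (x + y)) < 1 / Suc n)"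
    using approx by (auto simp: Bex_def)
  then obtain q where [measurable]: "\<And>n. q n \<in> borel_measurable (borel \<Otimes>\<^sub>M borel)"
    and q: "\<And>n x y. y \<in> K \<Longrightarrow> norm (q n (x, y) - h (x + y)) < 1 / Suc n"
    by metis
  show ?thesis
  proof (rule borel_measurable_LIMSEQ_metric)
    show "(\<lambda>p. indicator K (snd p) * q n p) \<in> borel_measurable (borel \<Otimes>\<^sub>M borel)" for n
      by measurable
    fix p :: "'a \<times> 'a"
    show "(\<lambda>n. indicator K (snd p) * q n p) \<longlonglongrightarrow> indicator K (snd p) * h (fst p + snd p)"
    proof (cases "snd p \<in> K")
      case True
      have "(\<lambda>n. q n p - h (fst p + snd p)) \<longlonglongrightarrow> 0"
      proof (rule tendsto_norm_zero_cancel, rule tendsto_sandwich[OF _ _ tendsto_const LIMSEQ_inverse_real_of_nat])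
        show "\<forall>\<^sub>F n in sequentially. norm (q n p - h (fst p + snd p)) \<le> inverse (real (Suc n))"
          using q[OF True, of _ "fst p"]
          by (auto intro!: always_eventually less_imp_le simp: inverse_eq_divide)
      qed auto
      then show ?thesis using True by (simp add: LIM_zero_iff)
    qed simp
  qed
qed

lemma borel_pair_shift_Cc:
  assumes h: "h \<in> Cc"
  shows "(\<lambda>p. indicator H (snd p) * h (fst p + snd p)) \<in> borel_measurable (borel \<Otimes>\<^sub>M borel)"
proof -
  obtain B :: "nat \<Rightarrow> 'a set" where B: "\<And>n. compact (B n)" "incseq B" "H = (\<Union>n. B n)"
    using H_exhaustion by blast
  show ?thesis
  proof (rule borel_measurable_LIMSEQ_metric)
    show "(\<lambda>p. indicator (B n) (snd p) * h (fst p + snd p)) \<in> borel_measurable (borel \<Otimes>\<^sub>M borel)" for n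
      by (rule borel_pair_shift_Cc_compact[OF h B(1)])
    show "(\<lambda>n. indicator (B n) (snd p) * h (fst p + snd p))
        \<longlonglongrightarrow> indicator H (snd p) * h (fst p + snd p)" for p :: "'a \<times> 'a"
      unfolding B(3) by (intro tendsto_mult LIMSEQ_indicator_incseq[OF B(2)] tendsto_const)
  qed
qed

text \<open>
  The integrable functions to which Fubini's theorem on \<open>H\<close> applies after a shift of the
  argument. Pointwise limits preserve the last condition, and every integrable function is equal
  almost everywhere to a function of this kind for a suitable \<open>H\<close>.
\<close>

definition adapted :: "('a \<Rightarrow> complex) \<Rightarrow> bool" where
  "adapted g \<longleftrightarrow> integrable M g \<and> (\<forall>x. x \<notin> H \<longrightarrow> g x = 0) \<and>
     (\<lambda>p. indicator H (snd p) * g (fst p + snd p)) \<in> borel_measurable (borel \<Otimes>\<^sub>M borel)"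

lemma adapted_Cc: "h \<in> Cc \<Longrightarrow> (\<And>x. x \<notin> H \<Longrightarrow> h x = 0) \<Longrightarrow> adapted h"
  by (simp add: adapted_def Cc_integrable borel_pair_shift_Cc)

lemma adapted_limit:
  assumes f: "integrable M f" and h: "\<And>n::nat. h n \<in> Cc" "\<And>n x. x \<notin> H \<Longrightarrow> h n x = 0"
    and lim: "AE x in M. (\<lambda>n. h n x) \<longlonglongrightarrow> f x"
  obtains g where "adapted g" "AE x in M. f x = g x"
proof -
  (* where h diverges, lim is some value that is a fixed function of the sequence, which is
     enough for the measurability of g *)
  define g where "g = (\<lambda>x. lim (\<lambda>n. h n x))"
  have [measurable]: "h n \<in> borel_measurable borel" for n by (rule Cc_borel[OF h(1)])
  have gb [measurable]: "g \<in> borel_measurable borel"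
    unfolding g_def by measurable
  have fb [measurable]: "f \<in> borel_measurable borel" by (rule integrable_borel[OF f])
  have ae: "AE x in M. f x = g x"
    using lim by eventually_elim (simp add: g_def limI)
  have "integrable M g"
    using f ae by (subst integrable_cong_AE[where g=f]) auto
  moreover have "g x = 0" if "x \<notin> H" for x
    using h(2)[OF that] by (simp add: g_def limI)
  moreover have "(\<lambda>p. indicator H (snd p) * g (fst p + snd p)) \<in> borel_measurable (borel \<Otimes>\<^sub>M borel)"
  proof -
    have [measurable]: "(\<lambda>p. indicator H (snd p) * h n (fst p + snd p)) \<in> borel_measurable (borel \<Otimes>\<^sub>M borel)" for n
      by (rule borel_pair_shift_Cc[OF h(1)])
    have "(\<lambda>p. indicator H (snd p) * lim (\<lambda>n. indicator H (snd p) * h n (fst p + snd p)))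
      \<in> borel_measurable (borel \<Otimes>\<^sub>M borel)" by measurable
    moreover have "(\<lambda>p. indicator H (snd p) * lim (\<lambda>n. indicator H (snd p) * h n (fst p + snd p)))
      = (\<lambda>p. indicator H (snd p) * g (fst p + snd p))"
      by (auto simp: g_def indicator_def)
    ultimately show ?thesis by simp
  qed
  ultimately have "adapted g" by (simp add: adapted_def)
  then show ?thesis using ae that by blast
qed

lemma adaptedD:
  assumes "adapted g"
  shows "integrable M g" "x \<notin> H \<Longrightarrow> g x = 0" "g \<in> borel_measurable borel"
    "(\<lambda>p. indicator H (snd p) * g (fst p + snd p)) \<in> borel_measurable (borel \<Otimes>\<^sub>M borel)"
  using assms integrable_borel by (auto simp: adapted_def)

lemma adapted_reflect:
  assumes "adapted g"
  shows "(\<lambda>p. indicator H (snd p) * g (fst p - snd p)) \<in> borel_measurable (borel \<Otimes>\<^sub>M borel)"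
proof -
  have "(\<lambda>p. (fst p, - snd p)) \<in> (borel \<Otimes>\<^sub>M borel) \<rightarrow>\<^sub>M (borel \<Otimes>\<^sub>M borel :: ('a \<times> 'a) measure)"
    by measurable
  from measurable_compose[OF this adaptedD(4)[OF assms]]
  show ?thesis by (simp add: indicator_def)
qed

section \<open>Invariance of Haar measure under reflection\<close>

lemma sets_NN: "sets (N \<Otimes>\<^sub>M N) = sets (borel \<Otimes>\<^sub>M borel)"
  by (intro sets_pair_measure_cong sets_N)

lemma measurable_NN: "borel_measurable (N \<Otimes>\<^sub>M N) = borel_measurable (borel \<Otimes>\<^sub>M borel)"
  by (intro measurable_cong_sets sets_NN refl)

lemma Tonelli_N:
  fixes F :: "'a \<times> 'a \<Rightarrow> ennreal"
  assumes "F \<in> borel_measurable (borel \<Otimes>\<^sub>M borel)"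
  shows "(\<integral>\<^sup>+x. \<integral>\<^sup>+y. F (x, y) \<partial>N \<partial>N) = (\<integral>\<^sup>+y. \<integral>\<^sup>+x. F (x, y) \<partial>N \<partial>N)"
  using NN.Fubini[of F] assms by (simp add: measurable_NN)

text \<open>
  The double integral of \<open>\<bar>g x\<bar> * \<bar>f (x - y)\<bar>\<close> gives the left side when \<open>y\<close> is
  integrated first. When \<open>x\<close> is integrated first, the substitution \<open>x + y\<close> for \<open>x\<close>
  turns it into the double integral of \<open>\<bar>g (x + y)\<bar> * \<bar>f x\<bar>\<close>, and a second exchange gives the
  right side.
\<close>

lemma nn_integral_reflect_adapted:
  assumes f: "adapted f" and g: "adapted g"
  shows "(\<integral>\<^sup>+y. norm (f (- y)) \<partial>N) * (\<integral>\<^sup>+x. norm (g x) \<partial>N)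
       = (\<integral>\<^sup>+x. norm (f x) \<partial>N) * (\<integral>\<^sup>+x. norm (g x) \<partial>N)"
proof -
  note [measurable] = adaptedD(3)[OF f] adaptedD(3)[OF g]
  define k1 where "k1 = (\<lambda>p. norm (indicator H (snd p) * f (fst p - snd p)))"
  define k2 where "k2 = (\<lambda>p. norm (indicator H (snd p) * g (fst p + snd p)))"
  have [measurable]: "k1 \<in> borel_measurable (borel \<Otimes>\<^sub>M borel)" "k2 \<in> borel_measurable (borel \<Otimes>\<^sub>M borel)"
    unfolding k1_def k2_def using adapted_reflect[OF f] adaptedD(4)[OF g] by measurable
  have [measurable]: "(\<lambda>y. k1 (x, y)) \<in> borel_measurable borel" "(\<lambda>y. k2 (x, y)) \<in> borel_measurable borel" for x
    by measurable
  have 1: "(\<integral>\<^sup>+y. k1 (x, y) \<partial>N) = (\<integral>\<^sup>+y. norm (f (- y)) \<partial>N)" if x: "x \<in> H" for x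
  proof -
    have "(\<integral>\<^sup>+y. k1 (x, y) \<partial>N) = (\<integral>\<^sup>+y. norm (f (- (y + (- x)))) \<partial>N)"
      using AE_N_H by (intro nn_integral_cong_AE) (auto elim!: eventually_mono simp: k1_def)
    also have "\<dots> = (\<integral>\<^sup>+y. norm (f (- y)) \<partial>N)"
      using x by (intro nn_integral_N_translate[where f="\<lambda>y. ennreal (norm (f (- y)))"]) auto
    finally show ?thesis .
  qed
  have 2: "(\<integral>\<^sup>+y. k2 (x, y) \<partial>N) = (\<integral>\<^sup>+y. norm (g y) \<partial>N)" if x: "x \<in> H" for x
  proof -
    have "(\<integral>\<^sup>+y. k2 (x, y) \<partial>N) = (\<integral>\<^sup>+y. norm (g (y + x)) \<partial>N)"
      using AE_N_H by (intro nn_integral_cong_AE) (auto elim!: eventually_mono simp: k2_def add.commute)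
    also have "\<dots> = (\<integral>\<^sup>+y. norm (g y) \<partial>N)"
      using x by (intro nn_integral_N_translate[where f="\<lambda>y. ennreal (norm (g y))"]) auto
    finally show ?thesis .
  qed
  have 3: "(\<integral>\<^sup>+x. norm (g x) * k1 (x, y) \<partial>N) = (\<integral>\<^sup>+x. norm (f x) * k2 (x, y) \<partial>N)" if y: "y \<in> H" for y
  proof -
    have "(\<integral>\<^sup>+x. norm (g x) * k1 (x, y) \<partial>N) = (\<integral>\<^sup>+x. norm (g (x + y)) * k1 (x + y, y) \<partial>N)"
      using nn_integral_N_translate[where f="\<lambda>x. ennreal (norm (g x) * k1 (x, y))", OF _ y] by simp
    also have "\<dots> = (\<integral>\<^sup>+x. norm (f x) * k2 (x, y) \<partial>N)"
      using y by (simp add: k1_def k2_def mult.commute)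
    finally show ?thesis .
  qed
  have "(\<integral>\<^sup>+y. norm (f (- y)) \<partial>N) * (\<integral>\<^sup>+x. norm (g x) \<partial>N)
      = (\<integral>\<^sup>+x. norm (g x) * (\<integral>\<^sup>+y. norm (f (- y)) \<partial>N) \<partial>N)"
    by (subst nn_integral_multc) (auto simp: mult.commute)
  also have "\<dots> = (\<integral>\<^sup>+x. norm (g x) * (\<integral>\<^sup>+y. k1 (x, y) \<partial>N) \<partial>N)"
    using AE_N_H by (intro nn_integral_cong_AE) (auto elim!: eventually_mono simp: 1)
  also have "\<dots> = (\<integral>\<^sup>+x. \<integral>\<^sup>+y. norm (g x) * k1 (x, y) \<partial>N \<partial>N)"
    by (subst nn_integral_cmult[symmetric]) (auto simp: ennreal_mult k1_def)
  also have "\<dots> = (\<integral>\<^sup>+y. \<integral>\<^sup>+x. norm (g x) * k1 (x, y) \<partial>N \<partial>N)"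
    using Tonelli_N[of "\<lambda>p. norm (g (fst p)) * k1 p"] by simp
  also have "\<dots> = (\<integral>\<^sup>+y. \<integral>\<^sup>+x. norm (f x) * k2 (x, y) \<partial>N \<partial>N)"
    using AE_N_H by (intro nn_integral_cong_AE) (auto elim!: eventually_mono simp: 3)
  also have "\<dots> = (\<integral>\<^sup>+x. \<integral>\<^sup>+y. norm (f x) * k2 (x, y) \<partial>N \<partial>N)"
    using Tonelli_N[of "\<lambda>p. norm (f (fst p)) * k2 p"] by simp
  also have "\<dots> = (\<integral>\<^sup>+x. norm (f x) * (\<integral>\<^sup>+y. k2 (x, y) \<partial>N) \<partial>N)"
    by (subst nn_integral_cmult[symmetric]) (auto simp: ennreal_mult k2_def)
  also have "\<dots> = (\<integral>\<^sup>+x. norm (f x) * (\<integral>\<^sup>+y. norm (g y) \<partial>N) \<partial>N)"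
    using AE_N_H by (intro nn_integral_cong_AE) (auto elim!: eventually_mono simp: 2)
  also have "\<dots> = (\<integral>\<^sup>+x. norm (f x) \<partial>N) * (\<integral>\<^sup>+x. norm (g x) \<partial>N)"
    by (rule nn_integral_multc) auto
  finally show ?thesis .
qed

lemma nn_integral_N_eq_M:
  assumes "f \<in> borel_measurable borel" and "\<And>x. x \<notin> H \<Longrightarrow> f x = 0"
  shows "(\<integral>\<^sup>+x. f x \<partial>N) = (\<integral>\<^sup>+x. f x \<partial>M)"
  unfolding nn_integral_N[OF assms(1)] using assms(2)
  by (intro nn_integral_cong) (auto simp: indicator_def)

end

context haar_lca
begin

lemma subgroup_containing:
  fixes K :: "nat \<Rightarrow> 'a set"
  assumes "\<And>n. compact (K n)"
  obtains H where "haar_lca_subgroup M H" "\<And>n. K n \<subseteq> H"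
proof -
  obtain H where "sigma_compact_subgroup H" "\<And>n. K n \<subseteq> H"
    using sigma_compact_subgroup_exists[of K] assms by blast
  then show ?thesis
    using that haar_lca_axioms by (simp add: haar_lca_subgroup_def haar_lca_subgroup_axioms_def)
qed

lemma Cc_support:
  assumes "h \<in> Cc"
  obtains K where "compact K" "\<And>x. x \<notin> K \<Longrightarrow> h x = 0"
  using assms unfolding Cc_def by blast

text \<open>
  The factor \<open>\<integral> \<bar>g\<bar>\<close> in \<open>nn_integral_reflect_adapted\<close> can be cancelled: a bump function \<open>g\<close> above the
  indicator of a compact neighbourhood has a positive and finite integral.
\<close>

lemma nn_integral_reflect_Cc:
  assumes h: "h \<in> Cc"
  shows "(\<integral>\<^sup>+y. norm (h (- y)) \<partial>M) = (\<integral>\<^sup>+y. norm (h y) \<partial>M)"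
proof -
  obtain V L :: "'a set" where VL: "open V" "compact L" "{0} \<subseteq> V" "V \<subseteq> L"
    using compact_neighbourhood[OF compact_sing] .
  obtain g :: "'a \<Rightarrow> real" where g: "(\<lambda>x. complex_of_real (g x)) \<in> Cc" "\<And>x. indicator L x \<le> g x"
    by (rule Cc_bump[OF VL(2) open_UNIV subset_UNIV]) blast
  obtain K1 where K1: "compact K1" "\<And>x. x \<notin> K1 \<Longrightarrow> h x = 0" using Cc_support[OF h] by blast
  obtain K2 where K2: "compact K2" "\<And>x. x \<notin> K2 \<Longrightarrow> complex_of_real (g x) = 0"
    using Cc_support[OF g(1)] by blast
  obtain H where HK: "haar_lca_subgroup M H" "K1 \<union> K2 \<subseteq> H"
    using subgroup_containing[of "\<lambda>_. K1 \<union> K2"] K1 K2 by auto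
  interpret haar_lca_subgroup M H by (fact HK(1))
  have ah: "adapted h"
    by (rule adapted_Cc[OF h]) (use HK(2) K1(2) in blast)
  have ag: "adapted (\<lambda>x. complex_of_real (g x))"
    by (rule adapted_Cc[OF g(1)]) (use HK(2) K2(2) in blast)
  note [measurable] = adaptedD(3)[OF ah] adaptedD(3)[OF ag]
  define I where "I = (\<integral>\<^sup>+x. norm (complex_of_real (g x)) \<partial>N)"
  have IM: "I = (\<integral>\<^sup>+x. norm (complex_of_real (g x)) \<partial>M)"
    unfolding I_def
  proof (rule nn_integral_N_eq_M)
    show "(\<lambda>x. ennreal (norm (complex_of_real (g x)))) \<in> borel_measurable borel" by measurable
  qed (use adaptedD(2)[OF ag] in simp)
  have "emeasure M V \<le> emeasure M L"
    using VL by (intro emeasure_mono) (auto simp: sets_M compact_imp_closed)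
  also have "\<dots> = (\<integral>\<^sup>+x. indicator L x \<partial>M)"
    using VL by (auto simp: sets_M compact_imp_closed)
  also have "\<dots> \<le> I"
    unfolding IM
  proof (intro nn_integral_mono)
    fix x show "indicator L x \<le> ennreal (norm (complex_of_real (g x)))"
      using g(2)[of x] by (auto simp: indicator_def ennreal_1[symmetric] simp del: ennreal_1)
  qed
  finally have "emeasure M V \<le> I" .
  moreover have "V \<noteq> {}" using VL(3) by auto
  ultimately have "I \<noteq> 0" using emeasure_open_pos[OF VL(1)] by (metis leD)
  moreover have "I \<noteq> \<infinity>"
    using Cc_integrable[OF g(1)] unfolding IM integrable_iff_bounded by auto
  moreover have "(\<integral>\<^sup>+y. norm (h (- y)) \<partial>N) * I = (\<integral>\<^sup>+y. norm (h y) \<partial>N) * I"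
    unfolding I_def by (rule nn_integral_reflect_adapted[OF ah ag])
  ultimately have "(\<integral>\<^sup>+y. norm (h (- y)) \<partial>N) = (\<integral>\<^sup>+y. norm (h y) \<partial>N)"
    by (auto simp: mult.commute[of _ I] ennreal_mult_cancel_left)
  then show ?thesis
    using adaptedD(2)[OF ah] by (simp add: nn_integral_N_eq_M)
qed

text \<open>
  For open sets, a bump function between a compact subset of the reflected set and the set itself
  compares the measures; outer regularity extends this to Borel sets.
\<close>

lemma emeasure_reflect_le:
  assumes B: "B \<in> sets borel"
  shows "emeasure M (uminus -` B) \<le> emeasure M B"
proof -
  have le: "emeasure M (uminus -` U) \<le> emeasure M U" if U: "open U" for U :: "'a set"
  proof -
    have oU: "open (uminus -` U)" using U by (intro open_vimage continuous_intros)
    show ?thesis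
      unfolding inner_regular_open[OF oU]
    proof (rule SUP_least)
      fix K assume "K \<in> {K. compact K \<and> K \<subseteq> uminus -` U}"
      then have K: "compact K" "K \<subseteq> uminus -` U" by auto
      have "compact (uminus ` K)" using K by (intro compact_continuous_image continuous_intros)
      moreover have "uminus ` K \<subseteq> U" using K by auto
      ultimately obtain h :: "'a \<Rightarrow> real" where h: "(\<lambda>x. complex_of_real (h x)) \<in> Cc"
        "\<And>x. indicator (uminus ` K) x \<le> h x" "\<And>x. h x \<le> indicator U x"
        using Cc_bump[OF _ U] by blast
      have "emeasure M K = (\<integral>\<^sup>+x. indicator K x \<partial>M)"
        using K by (simp add: sets_M compact_imp_closed)
      also have "\<dots> \<le> (\<integral>\<^sup>+x. norm (complex_of_real (h (- x))) \<partial>M)"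
      proof (intro nn_integral_mono)
        fix x show "indicator K x \<le> ennreal (norm (complex_of_real (h (- x))))"
          using h(2)[of "- x"] by (auto simp: indicator_def ennreal_1[symmetric] simp del: ennreal_1)
      qed
      also have "\<dots> = (\<integral>\<^sup>+x. norm (complex_of_real (h x)) \<partial>M)"
        by (rule nn_integral_reflect_Cc[OF h(1)])
      also have "\<dots> \<le> (\<integral>\<^sup>+x. indicator U x \<partial>M)"
      proof (intro nn_integral_mono)
        fix x
        have "0 \<le> h x" using h(2)[of x] by (meson indicator_pos_le order_trans)
        then show "ennreal (norm (complex_of_real (h x))) \<le> indicator U x"
          using h(3)[of x] by (auto simp: indicator_def ennreal_1[symmetric] simp del: ennreal_1 split: if_splits)
      qed
      also have "\<dots> = emeasure M U" using U by (simp add: sets_M)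
      finally show "emeasure M K \<le> emeasure M U" .
    qed
  qed
  show ?thesis
    unfolding outer_regular[OF B]
  proof (rule INF_greatest)
    fix U assume "U \<in> {U. open U \<and> B \<subseteq> U}"
    then have U: "open U" "B \<subseteq> U" by auto
    have "open (uminus -` U)" using U by (intro open_vimage continuous_intros) auto
    then have "emeasure M (uminus -` B) \<le> emeasure M (uminus -` U)"
      using U by (intro emeasure_mono) (auto simp: sets_M)
    with le[OF U(1)] show "emeasure M (uminus -` B) \<le> emeasure M U" by simp
  qed
qed

text \<open>
  This makes the cosine convolution depend only on the classes of its arguments: replacing
  \<open>g\<close> on a null set changes \<open>y \<mapsto> g (x - y)\<close> on a null set.
\<close>

lemma AE_reflect:
  assumes "AE x in M. P x"
  shows "AE y in M. P (x - y)"
proof -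
  obtain S where S: "S \<in> null_sets M" "{y. \<not> P y} \<subseteq> S"
    using assms by (auto simp: eventually_ae_filter)
  have Sb: "S \<in> sets borel" using S(1) by (auto simp: null_sets_def sets_M)
  have "emeasure M (uminus -` S) = 0"
    using emeasure_reflect_le[OF Sb] S(1) by (simp add: null_sets_def)
  moreover have "uminus -` S \<in> sets M" using measurable_sets[OF borel_uminus Sb] by (simp add: sets_M)
  ultimately have "AE y in M. P (- y)"
    using S(2) by (intro AE_I'[of "uminus -` S"]) (auto simp: null_sets_def)
  from AE_translate[OF this, of "- x"] show ?thesis by (simp add: algebra_simps)
qed

section \<open>The cosine convolution as an iterated integral\<close>

definition cos_translate :: "'a \<Rightarrow> ('a \<Rightarrow> complex) \<Rightarrow> 'a \<Rightarrow> complex" where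
  "cos_translate y g x = (g (x + y) + g (x - y)) / 2"

lemma cos_conv_translate: "cos_conv M f g x = (LINT y|M. f y * cos_translate y g x)"
  by (simp add: cos_conv_def cos_translate_def)

lemma integrable_cos_translate:
  assumes "integrable M g" shows "integrable M (cos_translate y g)"
  using integrable_translate[OF assms, of y] integrable_translate[OF assms, of "- y"]
  unfolding cos_translate_def by auto

lemma norm_cos_translate_le:
  assumes g: "integrable M g"
  shows "(LINT x|M. norm (cos_translate y g x)) \<le> (LINT x|M. norm (g x))"
proof -
  note [measurable] = integrable_borel[OF g]
  note i = integrable_translate[OF g, of y] integrable_translate[OF g, of "- y"]
  have "(LINT x|M. norm (cos_translate y g x)) \<le> (LINT x|M. (norm (g (x + y)) + norm (g (x + (- y)))) / 2)"
  proof (rule integral_mono)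
    show "norm (cos_translate y g x) \<le> (norm (g (x + y)) + norm (g (x + (- y)))) / 2" for x
      using norm_triangle_ineq[of "g (x + y)" "g (x - y)"] by (simp add: cos_translate_def norm_divide)
  qed (use i integrable_cos_translate[OF g] in auto)
  also have "\<dots> = ((LINT x|M. norm (g (x + y))) + (LINT x|M. norm (g (x + (- y))))) / 2"
    using i by simp
  also have "\<dots> = (LINT x|M. norm (g x))"
    by (subst (1 2) integral_translate[where f="\<lambda>x. norm (g x)"]) auto
  finally show ?thesis .
qed

text \<open>
  The two functions agree at every point and not only almost everywhere. Hence measurability of
  the convolution can be checked on good representatives, although the Haar measure on the Borel
  sets need not be complete.
\<close>

lemma cos_conv_cong_AE:
  assumes "integrable M f" "integrable M f'" "integrable M g" "integrable M g'"
    and f: "AE x in M. f x = f' x" and g: "AE x in M. g x = g' x"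
  shows "cos_conv M f g = cos_conv M f' g'"
proof
  fix x
  note [measurable] = assms(1-4)[THEN integrable_borel]
  have "AE y in M. g (y + x) = g' (y + x)" by (rule AE_translate[OF g])
  moreover have "AE y in M. g (x - y) = g' (x - y)" by (rule AE_reflect[OF g])
  ultimately have "AE y in M. f y * ((g (x + y) + g (x - y)) / 2) = f' y * ((g' (x + y) + g' (x - y)) / 2)"
    using f by eventually_elim (simp add: add.commute)
  then show "cos_conv M f g x = cos_conv M f' g' x"
    unfolding cos_conv_def
    by (intro integral_cong_AE) (auto simp: measurable_cong_sets[OF sets_M])
qed

lemma adapted_representatives:
  assumes f: "integrable M f" and g: "integrable M g"
  obtains H f' g' where "haar_lca_subgroup M H"
    "haar_lca_subgroup.adapted M H f'" "AE x in M. f x = f' x"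
    "haar_lca_subgroup.adapted M H g'" "AE x in M. g x = g' x"
proof -
  obtain h where h: "\<And>n::nat. h n \<in> Cc" "AE x in M. (\<lambda>n. h n x) \<longlonglongrightarrow> f x"
    using Cc_AE_limit[OF f] by blast
  obtain k where k: "\<And>n::nat. k n \<in> Cc" "AE x in M. (\<lambda>n. k n x) \<longlonglongrightarrow> g x"
    using Cc_AE_limit[OF g] by blast
  have "\<forall>n. \<exists>K. compact K \<and> (\<forall>x. x \<notin> K \<longrightarrow> h n x = 0 \<and> k n x = 0)"
  proof
    fix n
    obtain K1 where K1: "compact K1" "\<And>x. x \<notin> K1 \<Longrightarrow> h n x = 0" using Cc_support[OF h(1)] by blast
    obtain K2 where K2: "compact K2" "\<And>x. x \<notin> K2 \<Longrightarrow> k n x = 0" using Cc_support[OF k(1)] by blast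
    show "\<exists>K. compact K \<and> (\<forall>x. x \<notin> K \<longrightarrow> h n x = 0 \<and> k n x = 0)"
      using K1 K2 by (intro exI[of _ "K1 \<union> K2"]) auto
  qed
  then obtain K where K: "\<And>n. compact (K n)" "\<And>n x. x \<notin> K n \<Longrightarrow> h n x = 0 \<and> k n x = 0"
    by metis
  obtain H where HK: "haar_lca_subgroup M H" "\<And>n. K n \<subseteq> H"
    using subgroup_containing[of K] K(1) by blast
  interpret haar_lca_subgroup M H by (fact HK(1))
  obtain f' where "adapted f'" "AE x in M. f x = f' x"
    by (rule adapted_limit[OF f h(1) _ h(2)]) (use HK(2) K(2) in blast)+
  moreover obtain g' where "adapted g'" "AE x in M. g x = g' x"
    by (rule adapted_limit[OF g k(1) _ k(2)]) (use HK(2) K(2) in blast)+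
  ultimately show ?thesis using that HK(1) by blast
qed

end

context haar_lca_subgroup
begin

text \<open>
  The common form of all uses of Fubini's theorem below. Only the sections of \<open>k\<close> at points
  where \<open>f\<close> does not vanish enter the bound, so that \<open>C\<close> can exploit a small support of \<open>f\<close>.
\<close>

lemma kernel_integrable:
  fixes k :: "'a \<times> 'a \<Rightarrow> complex"
  assumes [measurable]: "k \<in> borel_measurable (borel \<Otimes>\<^sub>M borel)" and f: "integrable N f"
    and k: "\<And>y. y \<in> H \<Longrightarrow> f y \<noteq> 0 \<Longrightarrow> integrable N (\<lambda>x. k (x, y))"
    and C: "\<And>y. y \<in> H \<Longrightarrow> f y \<noteq> 0 \<Longrightarrow> (LINT x|N. norm (k (x, y))) \<le> C"
  shows "integrable (N \<Otimes>\<^sub>M N) (\<lambda>(x, y). f y * k (x, y))"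
    and "(LINT x|N. norm (LINT y|N. f y * k (x, y))) \<le> C * (LINT y|N. norm (f y))"
proof -
  have fb [measurable]: "f \<in> borel_measurable borel"
    using borel_measurable_integrable[OF f] by (simp add: measurable_cong_sets[OF sets_N])
  have m: "(\<lambda>p. f (snd p) * k p) \<in> borel_measurable (N \<Otimes>\<^sub>M N)"
    unfolding measurable_NN by measurable
  have "(\<integral>\<^sup>+p. norm (f (snd p) * k p) \<partial>(N \<Otimes>\<^sub>M N)) = (\<integral>\<^sup>+y. \<integral>\<^sup>+x. norm (f y * k (x, y)) \<partial>N \<partial>N)"
    using m by (subst NN.nn_integral_snd[symmetric]) (auto simp: case_prod_unfold)
  also have "\<dots> \<le> (\<integral>\<^sup>+y. ennreal C * norm (f y) \<partial>N)"
  proof (rule nn_integral_mono_AE)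
    show "AE y in N. (\<integral>\<^sup>+x. norm (f y * k (x, y)) \<partial>N) \<le> ennreal C * norm (f y)"
      using AE_N_H
    proof eventually_elim
      case (elim y)
      show ?case
      proof (cases "f y = 0")
        case False
        have kb: "(\<lambda>x. k (x, y)) \<in> borel_measurable borel" by measurable
        have "(\<integral>\<^sup>+x. norm (f y * k (x, y)) \<partial>N) = norm (f y) * (\<integral>\<^sup>+x. norm (k (x, y)) \<partial>N)"
          using kb by (subst nn_integral_cmult[symmetric])
            (auto simp: norm_mult ennreal_mult measurable_cong_sets[OF sets_N])
        also have "(\<integral>\<^sup>+x. norm (k (x, y)) \<partial>N) = ennreal (LINT x|N. norm (k (x, y)))"
          using k[OF elim False] by (intro nn_integral_eq_integral) auto
        also have "norm (f y) * \<dots> \<le> norm (f y) * ennreal C"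
          using C[OF elim False] by (intro mult_left_mono ennreal_leI) auto
        finally show ?thesis by (simp add: mult.commute)
      qed simp
    qed
  qed
  also have "\<dots> = ennreal C * (\<integral>\<^sup>+y. norm (f y) \<partial>N)"
    by (rule nn_integral_cmult) auto
  also have "\<dots> < \<infinity>"
    using f by (auto simp: integrable_iff_bounded ennreal_mult_less_top)
  finally have i: "integrable (N \<Otimes>\<^sub>M N) (\<lambda>p. f (snd p) * k p)"
    using m by (intro integrableI_bounded)
  then show I: "integrable (N \<Otimes>\<^sub>M N) (\<lambda>(x, y). f y * k (x, y))"
    by (simp add: case_prod_unfold)
  have In: "integrable (N \<Otimes>\<^sub>M N) (\<lambda>(x, y). norm (f y * k (x, y)))"
    using integrable_norm[OF I] by (simp add: case_prod_unfold)
  have "(LINT x|N. norm (LINT y|N. f y * k (x, y))) \<le> (LINT x|N. LINT y|N. norm (f y * k (x, y)))"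
    using NN.integrable_fst'[OF I] NN.integrable_fst'[OF In]
    by (intro integral_mono integrable_norm integral_norm_bound) auto
  also have "\<dots> = (LINT y|N. LINT x|N. norm (f y * k (x, y)))"
    by (rule NN.Fubini_integral[OF In, symmetric])
  also have "\<dots> \<le> (LINT y|N. C * norm (f y))"
  proof (rule integral_mono_AE)
    show "integrable N (\<lambda>y. LINT x|N. norm (f y * k (x, y)))" using NN.integrable_snd[OF In] .
    show "integrable N (\<lambda>y. C * norm (f y))" using f by auto
    show "AE y in N. (LINT x|N. norm (f y * k (x, y))) \<le> C * norm (f y)"
      using AE_N_H
    proof eventually_elim
      case (elim y)
      show ?case
        using C[OF elim] by (cases "f y = 0") (auto simp: norm_mult mult.commute mult_right_mono)
    qed
  qed
  also have "\<dots> = C * (LINT y|N. norm (f y))" by simp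
  finally show "(LINT x|N. norm (LINT y|N. f y * k (x, y))) \<le> C * (LINT y|N. norm (f y))" .
qed

definition cos_kernel :: "('a \<Rightarrow> complex) \<Rightarrow> 'a \<times> 'a \<Rightarrow> complex" where
  "cos_kernel g p = indicator H (snd p) * cos_translate (snd p) g (fst p)"

lemma cos_kernel_borel:
  assumes "adapted g" shows "cos_kernel g \<in> borel_measurable (borel \<Otimes>\<^sub>M borel)"
proof -
  note [measurable] = adaptedD(4)[OF assms] adapted_reflect[OF assms]
  have "(\<lambda>p. (indicator H (snd p) * g (fst p + snd p) + indicator H (snd p) * g (fst p - snd p)) / 2)
      \<in> borel_measurable (borel \<Otimes>\<^sub>M borel)" by measurable
  then show ?thesis by (simp add: cos_kernel_def[abs_def] cos_translate_def algebra_simps)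
qed

lemma cos_translate_outside:
  "adapted g \<Longrightarrow> y \<in> H \<Longrightarrow> x \<notin> H \<Longrightarrow> cos_translate y g x = 0"
  by (simp add: cos_translate_def adaptedD(2))

lemma integrable_N: "integrable M f \<Longrightarrow> \<forall>x. x \<notin> H \<longrightarrow> f x = 0 \<Longrightarrow> integrable N f" for f :: "'a \<Rightarrow> complex"
  by (simp add: integrable_N_iff integrable_borel)

lemma cos_kernel_section:
  assumes g: "adapted g" and y: "y \<in> H"
  shows "integrable N (\<lambda>x. cos_kernel g (x, y))"
    and "(LINT x|N. norm (cos_kernel g (x, y))) \<le> (LINT x|M. norm (g x))"
proof -
  have i: "integrable M (cos_translate y g)"
    using integrable_cos_translate[OF adaptedD(1)[OF g]] .
  have e: "(\<lambda>x. cos_kernel g (x, y)) = cos_translate y g"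
    using y by (simp add: cos_kernel_def)
  show "integrable N (\<lambda>x. cos_kernel g (x, y))"
    unfolding e using i cos_translate_outside[OF g y] by (intro integrable_N) auto
  have "(LINT x|N. norm (cos_translate y g x)) = (LINT x|M. norm (cos_translate y g x))"
    using cos_translate_outside[OF g y] integrable_borel[OF i] by (intro integral_N) auto
  then show "(LINT x|N. norm (cos_kernel g (x, y))) \<le> (LINT x|M. norm (g x))"
    using norm_cos_translate_le[OF adaptedD(1)[OF g], of y] y by (simp add: cos_kernel_def)
qed

lemma cos_kernel_integrable:
  assumes g: "adapted g" and f: "integrable M f" "\<forall>x. x \<notin> H \<longrightarrow> f x = 0"
  shows "integrable (N \<Otimes>\<^sub>M N) (\<lambda>(x, y). f y * cos_kernel g (x, y))"
    and "(LINT x|N. norm (LINT y|N. f y * cos_kernel g (x, y)))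
      \<le> (LINT x|M. norm (g x)) * (LINT y|N. norm (f y))"
  by (rule kernel_integrable[OF cos_kernel_borel[OF g] integrable_N[OF f]
        cos_kernel_section(1)[OF g] cos_kernel_section(2)[OF g]]; assumption)+

lemma cos_conv_eq_kernel:
  assumes g: "adapted g" and f: "integrable M f" "\<forall>x. x \<notin> H \<longrightarrow> f x = 0"
  shows "cos_conv M f g x = (LINT y|N. f y * cos_kernel g (x, y))"
proof -
  note [measurable] = adaptedD(3)[OF g] integrable_borel[OF f(1)]
  have "(LINT y|N. f y * cos_kernel g (x, y)) = (LINT y|M. f y * cos_kernel g (x, y))"
    using f(2) by (intro integral_N) (auto simp: cos_kernel_def cos_translate_def)
  also have "\<dots> = cos_conv M f g x"
    unfolding cos_conv_translate using f(2)
    by (intro Bochner_Integration.integral_cong) (auto simp: cos_kernel_def indicator_def)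
  finally show ?thesis ..
qed

lemma cos_conv_outside:
  assumes g: "adapted g" and f: "integrable M f" "\<forall>x. x \<notin> H \<longrightarrow> f x = 0" and x: "x \<notin> H"
  shows "cos_conv M f g x = 0"
proof -
  have "f y * cos_translate y g x = 0" for y
    using cos_translate_outside[OF g _ x, of y] f(2) by (cases "y \<in> H") auto
  then show ?thesis unfolding cos_conv_translate by (simp only: integral_zero)
qed

lemma cos_conv_integrable_adapted:
  assumes g: "adapted g" and f: "integrable M f" "\<forall>x. x \<notin> H \<longrightarrow> f x = 0"
  shows "integrable M (cos_conv M f g)"
proof -
  have "integrable N (\<lambda>x. LINT y|N. f y * cos_kernel g (x, y))"
    using NN.integrable_fst'[OF cos_kernel_integrable(1)[OF g f]] by simp
  then have i: "integrable N (cos_conv M f g)"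
    by (subst ext[of "cos_conv M f g", OF cos_conv_eq_kernel[OF g f]])
  moreover have "cos_conv M f g \<in> borel_measurable borel"
    using borel_measurable_integrable[OF i] by (simp add: measurable_cong_sets[OF sets_N])
  ultimately show ?thesis using integrable_N_iff cos_conv_outside[OF g f] by blast
qed

lemma integral_cos_conv_mult:
  assumes g: "adapted g" and f: "integrable M f" "\<forall>x. x \<notin> H \<longrightarrow> f x = 0"
    and b [measurable]: "\<phi> \<in> borel_measurable borel" and bd: "\<And>x. norm (\<phi> x) \<le> C"
  shows "(LINT x|M. cos_conv M f g x * \<phi> x) = (LINT y|M. f y * (LINT x|M. cos_translate y g x * \<phi> x))"
proof -
  note [measurable] = adaptedD(3)[OF g] integrable_borel[OF f(1)] cos_kernel_borel[OF g]
  define k where "k = (\<lambda>p. cos_kernel g p * \<phi> (fst p))"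
  have C0: "0 \<le> C" using norm_ge_zero bd order_trans by blast
  have kb: "k \<in> borel_measurable (borel \<Otimes>\<^sub>M borel)" unfolding k_def by measurable
  have sec: "integrable N (\<lambda>x. k (x, y))" and secn: "(LINT x|N. norm (k (x, y))) \<le> C * (LINT x|M. norm (g x))"
    if y: "y \<in> H" for y
  proof -
    have bb: "norm (k (x, y)) \<le> C * norm (cos_kernel g (x, y))" for x
      using bd[of x] mult_left_mono[OF bd[of x] norm_ge_zero[of "cos_kernel g (x, y)"]]
      by (simp add: k_def norm_mult mult.commute)
    have i: "integrable N (\<lambda>x. C * norm (cos_kernel g (x, y)))"
      using cos_kernel_section(1)[OF g y] by auto
    have "(\<lambda>x. k (x, y)) \<in> borel_measurable borel" using kb by measurable
    then have m: "(\<lambda>x. k (x, y)) \<in> borel_measurable N"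
      by (simp add: measurable_cong_sets[OF sets_N])
    show 1: "integrable N (\<lambda>x. k (x, y))"
      using i m by (rule Bochner_Integration.integrable_bound) (use bb in \<open>auto intro!: AE_I2 order_trans[OF bb]\<close>)
    have "(LINT x|N. norm (k (x, y))) \<le> (LINT x|N. C * norm (cos_kernel g (x, y)))"
      using 1 i bb by (intro integral_mono) auto
    also have "\<dots> \<le> C * (LINT x|M. norm (g x))"
      using cos_kernel_section(2)[OF g y] C0 by (simp add: mult_left_mono)
    finally show "(LINT x|N. norm (k (x, y))) \<le> C * (LINT x|M. norm (g x))" .
  qed
  have I: "integrable (N \<Otimes>\<^sub>M N) (\<lambda>(x, y). f y * k (x, y))"
    by (rule kernel_integrable(1)[OF kb integrable_N[OF f] sec secn])
  have eq: "(LINT x|N. f y * k (x, y)) = f y * (LINT x|M. cos_translate y g x * \<phi> x)" for y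
  proof (cases "y \<in> H")
    case True
    have [measurable]: "cos_translate y g \<in> borel_measurable borel"
      using integrable_cos_translate[OF adaptedD(1)[OF g]] integrable_borel by blast
    have "(LINT x|N. k (x, y)) = (LINT x|N. cos_translate y g x * \<phi> x)"
      using True by (simp add: k_def cos_kernel_def)
    also have "\<dots> = (LINT x|M. cos_translate y g x * \<phi> x)"
      using cos_translate_outside[OF g True] by (intro integral_N) auto
    finally show ?thesis by simp
  qed (simp add: f(2))
  have cb [measurable]: "cos_conv M f g \<in> borel_measurable borel"
    by (intro integrable_borel cos_conv_integrable_adapted g f)
  have "(LINT x|M. cos_conv M f g x * \<phi> x) = (LINT x|N. cos_conv M f g x * \<phi> x)"
    using cos_conv_outside[OF g f] by (intro integral_N[symmetric]) auto
  also have "\<dots> = (LINT x|N. LINT y|N. f y * k (x, y))"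
    by (simp add: cos_conv_eq_kernel[OF g f] k_def flip: mult.assoc)
  also have "\<dots> = (LINT y|N. LINT x|N. f y * k (x, y))"
    by (rule NN.Fubini_integral[OF I, symmetric])
  also have "\<dots> = (LINT y|N. f y * (LINT x|M. cos_translate y g x * \<phi> x))"
    by (simp only: eq)
  also have "\<dots> = (LINT y|M. f y * (LINT x|M. cos_translate y g x * \<phi> x))"
  proof (rule integral_N)
    have "(\<lambda>y. LINT x|N. f y * k (x, y)) \<in> borel_measurable N"
      using NN.integrable_snd[OF I] by auto
    then show "(\<lambda>y. f y * (LINT x|M. cos_translate y g x * \<phi> x)) \<in> borel_measurable borel"
      unfolding eq measurable_cong_sets[OF sets_N refl] .
  qed (simp add: f(2))
  finally show ?thesis .
qed

end

context haar_lca
begin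

section \<open>Functions in the cosine class give characters\<close>

lemma Cc_mult_continuous:
  assumes h: "h \<in> Cc" and c: "continuous_on UNIV \<psi>"
  shows "(\<lambda>x. \<psi> x * h x) \<in> Cc"
proof -
  obtain K where K: "compact K" "\<forall>x. x \<notin> K \<longrightarrow> h x = 0" and hc: "continuous_on UNIV h"
    using h unfolding Cc_def by auto
  have "continuous_on UNIV (\<lambda>x. \<psi> x * h x)" using hc c by (intro continuous_intros)
  moreover have "\<exists>K. compact K \<and> (\<forall>x. x \<notin> K \<longrightarrow> \<psi> x * h x = 0)"
    using K by (intro exI[of _ K]) simp
  ultimately show ?thesis by (simp add: Cc_def)
qed

text \<open>
  Testing with \<open>cnj \<psi> * h\<close> for a bump function \<open>h\<close> at \<open>x\<close> makes the integrand
  \<open>\<bar>\<psi>\<bar>\<^sup>2 * h\<close> nonnegative and continuous; integral \<open>0\<close> would make it vanish almost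
  everywhere, but it is positive on an open set around \<open>x\<close> unless \<open>\<psi> x = 0\<close>.
\<close>

lemma continuous_eq_zero_if_annihilates_L1:
  fixes \<psi> :: "'a \<Rightarrow> complex"
  assumes c: "continuous_on UNIV \<psi>"
    and zero: "\<And>f. integrable M f \<Longrightarrow> (LINT x|M. f x * \<psi> x) = 0"
  shows "\<psi> x = 0"
proof (rule ccontr)
  assume nz: "\<psi> x \<noteq> 0"
  obtain h :: "'a \<Rightarrow> real" where h: "(\<lambda>x. complex_of_real (h x)) \<in> Cc" "\<And>y. indicator {x} y \<le> h y"
    by (rule Cc_bump[OF compact_sing open_UNIV subset_UNIV]) blast
  have h0: "0 \<le> h y" for y using h(2)[of y] by (meson indicator_pos_le order_trans)
  have hx: "1 \<le> h x" using h(2)[of x] by simp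
  have f: "(\<lambda>y. cnj (\<psi> y) * complex_of_real (h y)) \<in> Cc"
    using h(1) c by (intro Cc_mult_continuous continuous_intros)
  define q where "q = (\<lambda>y. (norm (\<psi> y))\<^sup>2 * h y)"
  have q: "complex_of_real (q y) = \<psi> y * (cnj (\<psi> y) * complex_of_real (h y))" for y
    unfolding q_def of_real_mult complex_norm_square by (simp only: mult.assoc)
  have qCc: "(\<lambda>y. complex_of_real (q y)) \<in> Cc"
    unfolding q using f c by (rule Cc_mult_continuous)
  have "integrable M (\<lambda>y. Re (complex_of_real (q y)))"
    using Cc_integrable[OF qCc] by (rule integrable_Re)
  then have qi: "integrable M q" by simp
  have "complex_of_real (LINT y|M. q y) = (LINT y|M. cnj (\<psi> y) * complex_of_real (h y) * \<psi> y)"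
    by (simp add: q mult.commute flip: integral_complex_of_real)
  also have "\<dots> = 0" by (rule zero[OF Cc_integrable[OF f]])
  finally have "(LINT y|M. q y) = 0" by simp
  then have ae: "AE y in M. q y = 0"
    using qi h0 by (subst (asm) integral_nonneg_eq_0_iff_AE) (auto simp: q_def)
  have "continuous_on UNIV (\<lambda>y. Re (complex_of_real (q y)))"
    using qCc unfolding Cc_def by (intro continuous_intros) auto
  then have qc: "continuous_on UNIV q" by simp
  have o: "open {y. 0 < q y}" by (rule open_Collect_less[OF continuous_on_const qc])
  have "AE y in M. y \<notin> {y. 0 < q y}" using ae by eventually_elim simp
  then have "emeasure M {y. 0 < q y} = 0"
    using AE_iff_null_sets[of "{y. 0 < q y}" M] o by (auto simp: sets_M null_sets_def)
  moreover have "x \<in> {y. 0 < q y}" using nz hx by (auto simp: q_def)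
  ultimately show False using emeasure_open_pos[OF o] by auto
qed

lemma L1_class_in_L1: "integrable M f \<Longrightarrow> L1_class M f \<in> L1 M"
  by (auto simp: L1_def L1_class_def intro: quotientI)

lemma L1_E:
  assumes "F \<in> L1 M" obtains f where "integrable M f" "F = L1_class M f"
  using assms unfolding L1_def L1_class_def quotient_def by auto

lemma cos_conv_integrable:
  assumes f: "integrable M f" and g: "integrable M g"
  shows "integrable M (cos_conv M f g)"
proof -
  obtain H f' g' where HK: "haar_lca_subgroup M H"
    "haar_lca_subgroup.adapted M H f'" "AE x in M. f x = f' x"
    "haar_lca_subgroup.adapted M H g'" "AE x in M. g x = g' x"
    using adapted_representatives[OF f g] .
  interpret haar_lca_subgroup M H by (fact HK(1))
  have "cos_conv M f g = cos_conv M f' g'"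
    using HK f g adaptedD(1) by (intro cos_conv_cong_AE) auto
  moreover have "integrable M (cos_conv M f' g')"
    using adaptedD(1,2)[OF HK(2)] by (intro cos_conv_integrable_adapted HK) auto
  ultimately show ?thesis by simp
qed

lemma COS_D:
  assumes "\<phi> \<in> COS"
  shows "continuous_on UNIV \<phi>" "\<phi> \<in> borel_measurable borel" "\<exists>C. \<forall>x. norm (\<phi> x) \<le> C"
    "\<phi> x * \<phi> y = (\<phi> (x + y) + \<phi> (x - y)) / 2"
  using assms unfolding COS_def bcontfun_def bounded_iff
  by (auto intro: borel_measurable_continuous_onI)

lemma integrable_mult_bounded:
  fixes f \<psi> :: "'a \<Rightarrow> complex"
  assumes f: "integrable M f" and m: "\<psi> \<in> borel_measurable borel" and C: "\<And>x. norm (\<psi> x) \<le> C"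
  shows "integrable M (\<lambda>x. f x * \<psi> x)"
proof (rule Bochner_Integration.integrable_bound)
  show "integrable M (\<lambda>x. C * norm (f x))" using f by auto
  show "(\<lambda>x. f x * \<psi> x) \<in> borel_measurable M"
    using integrable_borel[OF f] m unfolding measurable_cong_sets[OF sets_M refl] by measurable
  show "AE x in M. norm (f x * \<psi> x) \<le> norm (C * norm (f x))"
  proof (rule AE_I2)
    fix x
    have "norm (f x * \<psi> x) \<le> C * norm (f x)"
      using mult_left_mono[OF C[of x] norm_ge_zero[of "f x"]] by (simp add: norm_mult mult.commute)
    then show "norm (f x * \<psi> x) \<le> norm (C * norm (f x))" by (metis abs_ge_self order_trans real_norm_def)
  qed
qed

text \<open>
  Translations move from \<open>g\<close> to \<open>\<phi>\<close> under the integral, where the cosine equation splits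
  off the factor \<open>\<phi> y\<close>.
\<close>

lemma integral_cos_translate_COS:
  assumes \<phi>: "\<phi> \<in> COS" and g: "integrable M g"
  shows "(LINT x|M. cos_translate y g x * \<phi> x) = (LINT x|M. g x * \<phi> x) * \<phi> y"
proof -
  note [measurable] = COS_D(2)[OF \<phi>] integrable_borel[OF g]
  obtain C where C: "\<And>x. norm (\<phi> x) \<le> C" using COS_D(3)[OF \<phi>] by blast
  have i: "integrable M (\<lambda>x. g x * \<phi> (x + a))" for a
    by (rule integrable_mult_bounded[OF g _ C]) measurable
  have i': "integrable M (\<lambda>x. g (x + a) * \<phi> x)" for a
    by (rule integrable_mult_bounded[OF integrable_translate[OF g] _ C]) measurable
  have t: "(LINT x|M. g (x + a) * \<phi> x) = (LINT x|M. g x * \<phi> (x - a))" for a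
    using integral_translate[of "\<lambda>x. g x * \<phi> (x - a)" a] by simp
  have "(LINT x|M. cos_translate y g x * \<phi> x)
      = (LINT x|M. (g (x + y) * \<phi> x + g (x + (- y)) * \<phi> x) / 2)"
    by (simp add: cos_translate_def algebra_simps)
  also have "\<dots> = ((LINT x|M. g (x + y) * \<phi> x) + (LINT x|M. g (x + (- y)) * \<phi> x)) / 2"
    using i'[of y] i'[of "- y"] by simp
  also have "\<dots> = ((LINT x|M. g x * \<phi> (x + (- y))) + (LINT x|M. g x * \<phi> (x + y))) / 2"
    unfolding t by simp
  also have "\<dots> = (LINT x|M. (g x * \<phi> (x + (- y)) + g x * \<phi> (x + y)) / 2)"
    using i[of y] i[of "- y"] by simp
  also have "\<dots> = (LINT x|M. g x * \<phi> x * \<phi> y)"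
  proof (intro Bochner_Integration.integral_cong refl)
    fix x
    show "(g x * \<phi> (x + (- y)) + g x * \<phi> (x + y)) / 2 = g x * \<phi> x * \<phi> y"
      unfolding mult.assoc COS_D(4)[OF \<phi>] by (simp add: algebra_simps)
  qed
  also have "\<dots> = (LINT x|M. g x * \<phi> x) * \<phi> y" by simp
  finally show ?thesis .
qed

lemma integral_cos_conv_COS:
  assumes \<phi>: "\<phi> \<in> COS" and f: "integrable M f" and g: "integrable M g"
  shows "(LINT x|M. cos_conv M f g x * \<phi> x) = (LINT x|M. f x * \<phi> x) * (LINT x|M. g x * \<phi> x)"
proof -
  obtain H f' g' where HK: "haar_lca_subgroup M H"
    "haar_lca_subgroup.adapted M H f'" "AE x in M. f x = f' x"
    "haar_lca_subgroup.adapted M H g'" "AE x in M. g x = g' x"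
    using adapted_representatives[OF f g] .
  interpret haar_lca_subgroup M H by (fact HK(1))
  note f' = adaptedD(1)[OF HK(2)] and g' = adaptedD(1)[OF HK(4)]
  note [measurable] = COS_D(2)[OF \<phi>] integrable_borel[OF f] integrable_borel[OF g]
    integrable_borel[OF f'] integrable_borel[OF g']
  obtain C where C: "\<And>x. norm (\<phi> x) \<le> C" using COS_D(3)[OF \<phi>] by blast
  have e: "(LINT x|M. f x * \<phi> x) = (LINT x|M. f' x * \<phi> x)" "(LINT x|M. g x * \<phi> x) = (LINT x|M. g' x * \<phi> x)"
    using HK(3,5) by (auto intro!: integral_cong_AE simp: measurable_cong_sets[OF sets_M])
  have "cos_conv M f g = cos_conv M f' g'"
    using HK f g f' g' by (intro cos_conv_cong_AE) auto
  then have "(LINT x|M. cos_conv M f g x * \<phi> x) = (LINT y|M. f' y * (LINT x|M. cos_translate y g' x * \<phi> x))"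
    using integral_cos_conv_mult[OF HK(4) f' _ COS_D(2)[OF \<phi>] C] adaptedD(2)[OF HK(2)] by simp
  also have "\<dots> = (LINT y|M. (LINT x|M. g' x * \<phi> x) * (f' y * \<phi> y))"
    unfolding integral_cos_translate_COS[OF \<phi> g'] by (simp add: mult_ac)
  also have "\<dots> = (LINT x|M. g' x * \<phi> x) * (LINT y|M. f' y * \<phi> y)" by simp
  finally show ?thesis unfolding e by (simp only: mult.commute)
qed

lemma m_fun_COS_in_Delta:
  assumes \<phi>: "\<phi> \<in> COS"
  shows "m_fun M \<phi> \<in> Delta M"
proof -
  note val = m_fun_L1_class[OF haar \<phi>]
  obtain C where C: "\<And>x. norm (\<phi> x) \<le> C" using COS_D(3)[OF \<phi>] by blast
  have C0: "0 \<le> C" using norm_ge_zero C order_trans by blast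
  note int = integrable_mult_bounded[OF _ COS_D(2)[OF \<phi>] C]
  have nz: "\<exists>F\<in>L1 M. m_fun M \<phi> F \<noteq> 0"
  proof (rule ccontr)
    assume "\<not> ?thesis"
    then have "(LINT x|M. f x * \<phi> x) = 0" if "integrable M f" for f
      using val[OF that] L1_class_in_L1[OF that] by auto
    then have "\<phi> = (\<lambda>_. 0)"
      using continuous_eq_zero_if_annihilates_L1[OF COS_D(1)[OF \<phi>]] by blast
    then show False using \<phi> by (simp add: COS_def)
  qed
  have cont: "\<exists>d>0. \<forall>g. integrable M g \<longrightarrow> (LINT x|M. norm (g x - f x)) < d \<longrightarrow>
      dist (m_fun M \<phi> (L1_class M g)) (m_fun M \<phi> (L1_class M f)) < e"
    if f: "integrable M f" and e: "e > 0" for f e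
  proof (intro exI[of _ "e / (C + 1)"] conjI allI impI)
    show "0 < e / (C + 1)" using e C0 by simp
    fix g assume g: "integrable M g" and d: "(LINT x|M. norm (g x - f x)) < e / (C + 1)"
    have "dist (m_fun M \<phi> (L1_class M g)) (m_fun M \<phi> (L1_class M f))
        = norm (LINT x|M. (g x - f x) * \<phi> x)"
      using int[OF f] int[OF g] by (simp add: val f g dist_norm algebra_simps)
    also have "\<dots> \<le> (LINT x|M. norm ((g x - f x) * \<phi> x))" by (rule integral_norm_bound)
    also have "\<dots> \<le> (LINT x|M. (C + 1) * norm (g x - f x))"
    proof (rule integral_mono)
      show "integrable M (\<lambda>x. norm ((g x - f x) * \<phi> x))"
        using f g by (intro integrable_norm int) auto
      show "integrable M (\<lambda>x. (C + 1) * norm (g x - f x))" using f g by auto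
      fix x
      have "norm (\<phi> x) \<le> C + 1" using C[of x] by simp
      then show "norm ((g x - f x) * \<phi> x) \<le> (C + 1) * norm (g x - f x)"
        by (simp add: norm_mult mult.commute mult_right_mono)
    qed
    also have "\<dots> = (C + 1) * (LINT x|M. norm (g x - f x))" by simp
    also have "\<dots> < e" using d C0 by (simp add: field_simps)
    finally show "dist (m_fun M \<phi> (L1_class M g)) (m_fun M \<phi> (L1_class M f)) < e" .
  qed
  have add: "m_fun M \<phi> (L1_class M (\<lambda>x. f x + g x)) = m_fun M \<phi> (L1_class M f) + m_fun M \<phi> (L1_class M g)"
    if "integrable M f" "integrable M g" for f g
    using that int by (simp add: val distrib_right)
  have scale: "m_fun M \<phi> (L1_class M (\<lambda>x. c * f x)) = c * m_fun M \<phi> (L1_class M f)"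
    if "integrable M f" for c f
    using that by (simp add: val mult.assoc)
  have mult: "m_fun M \<phi> (L1_class M (cos_conv M f g)) = m_fun M \<phi> (L1_class M f) * m_fun M \<phi> (L1_class M g)"
    if "integrable M f" "integrable M g" for f g
    using that by (simp add: val cos_conv_integrable integral_cos_conv_COS[OF \<phi>])
  have "m_fun M \<phi> \<in> extensional (L1 M)" by (simp add: m_fun_def)
  then show ?thesis
    unfolding Delta_def using nz cont add scale mult by blast
qed

section \<open>Continuity of translations in the norm\<close>

lemma L1_translation_continuous:
  fixes g :: "'a \<Rightarrow> complex"
  assumes g: "integrable M g" and e: "e > 0"
  obtains U where "open U" "0 \<in> U" "\<And>u. u \<in> U \<Longrightarrow> (LINT x|M. norm (g (x + u) - g x)) < e"
proof -
  obtain h where h: "h \<in> Cc" "(LINT x|M. norm (g x - h x)) < e / 3"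
    using Cc_dense[OF g, of "e / 3"] e by auto
  obtain K where K: "compact K" "\<And>x. x \<notin> K \<Longrightarrow> h x = 0" using Cc_support[OF h(1)] by blast
  obtain V L :: "'a set" where VL: "open V" "compact L" "{0} \<subseteq> V" "V \<subseteq> L"
    using compact_neighbourhood[OF compact_sing] .
  (* K' contains the support of the difference of h and its translate by any u in L *)
  define K' where "K' = K \<union> (\<lambda>p. fst p - snd p) ` (K \<times> L)"
  have K': "compact K'" unfolding K'_def using K VL
    by (intro compact_Un compact_continuous_image compact_Times continuous_intros)
  define c where "c = e / (3 * (measure M K' + 1))"
  have c: "c > 0" unfolding c_def using e by (simp add: add_nonneg_pos)
  obtain W where W: "open W" "0 \<in> W" "\<And>x u. u \<in> W \<Longrightarrow> norm (h (x + u) - h x) < c"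
    by (rule Cc_uniformly_continuous[OF h(1) c]) blast
  have "(LINT x|M. norm (g (x + u) - g x)) < e" if u: "u \<in> V \<inter> W" for u
  proof -
    have hi: "integrable M h" by (rule Cc_integrable[OF h(1)])
    note [measurable] = integrable_borel[OF g] integrable_borel[OF hi]
    have 1: "(LINT x|M. norm (g (x + u) - h (x + u))) = (LINT x|M. norm (g x - h x))"
      using integral_translate[of "\<lambda>x. norm (g x - h x)" u] by simp
    have b: "norm (h (x + u) - h x) \<le> c * indicator K' x" for x
    proof (cases "x \<in> K'")
      case False
      have "x + u \<notin> K"
      proof
        assume "x + u \<in> K"
        moreover have "u \<in> L" using u VL by auto
        ultimately have "(x + u) - u \<in> K'" unfolding K'_def by force
        then show False using False by simp
      qed
      moreover have "x \<notin> K" using False by (simp add: K'_def)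
      ultimately show ?thesis using K(2) False by simp
    qed (use W(3)[of u x] u in simp)
    note ti = integrable_translate[OF g, of u] integrable_translate[OF hi, of u]
    have "(LINT x|M. norm (h (x + u) - h x)) \<le> (LINT x|M. c * indicator K' x)"
      using b integrable_indicator_compact[OF K'] ti hi by (intro integral_mono) auto
    also have "\<dots> = c * measure M K'"
      using K' by (simp add: sets_M compact_imp_closed)
    also have "\<dots> < e / 3"
    proof -
      have "c * measure M K' < c * (measure M K' + 1)" using c by simp
      also have "\<dots> = e / 3"
        unfolding c_def using measure_nonneg[of M K'] by (simp add: field_simps add_nonneg_pos del: measure_nonneg)
      finally show ?thesis .
    qed
    finally have 2: "(LINT x|M. norm (h (x + u) - h x)) < e / 3" .
    have "(LINT x|M. norm (g (x + u) - g x))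
       \<le> (LINT x|M. norm (g (x + u) - h (x + u)) + norm (h (x + u) - h x) + norm (g x - h x))"
    proof (rule integral_mono)
      fix x
      show "norm (g (x + u) - g x) \<le> norm (g (x + u) - h (x + u)) + norm (h (x + u) - h x) + norm (g x - h x)"
        using norm_triangle_ineq4[of "(g (x + u) - h (x + u)) + (h (x + u) - h x)" "g x - h x"]
          norm_triangle_ineq[of "g (x + u) - h (x + u)" "h (x + u) - h x"] by simp
    qed (use g hi ti in auto)
    also have "\<dots> = (LINT x|M. norm (g (x + u) - h (x + u))) + (LINT x|M. norm (h (x + u) - h x)) + (LINT x|M. norm (g x - h x))"
      using g hi ti by simp
    also have "\<dots> < e" using 1 2 h(2) by simp
    finally show ?thesis .
  qed
  moreover have "open (V \<inter> W)" "0 \<in> V \<inter> W" using VL W by auto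
  ultimately show ?thesis using that by blast
qed

lemma L1_cos_translate_uniformly_continuous:
  assumes g: "integrable M g" and e: "e > 0"
  obtains U where "open U" "0 \<in> U"
    "\<And>t y. t - y \<in> U \<Longrightarrow> (LINT x|M. norm (cos_translate t g x - cos_translate y g x)) < e"
proof -
  obtain U where U: "open U" "0 \<in> U" "\<And>u. u \<in> U \<Longrightarrow> (LINT x|M. norm (g (x + u) - g x)) < e"
    by (rule L1_translation_continuous[OF g e]) blast
  note [measurable] = integrable_borel[OF g]
  have shift: "(LINT x|M. norm (g (x + a) - g (x + b))) = (LINT x|M. norm (g (x + (a - b)) - g x))" for a b
    using integral_translate[of "\<lambda>x. norm (g (x + (a - b)) - g x)" b] by (simp add: algebra_simps)
  have "(LINT x|M. norm (cos_translate t g x - cos_translate y g x)) < e"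
    if ty: "t - y \<in> U \<inter> uminus -` U" for t y
  proof -
    note i = integrable_translate[OF g]
    have "(LINT x|M. norm (cos_translate t g x - cos_translate y g x))
        \<le> (LINT x|M. (norm (g (x + t) - g (x + y)) + norm (g (x + (- t)) - g (x + (- y)))) / 2)"
    proof (rule integral_mono)
      fix x
      have eq: "cos_translate t g x - cos_translate y g x = ((g (x + t) - g (x + y)) + (g (x + (- t)) - g (x + (- y)))) / 2"
        by (simp add: cos_translate_def field_simps)
      show "norm (cos_translate t g x - cos_translate y g x) \<le> (norm (g (x + t) - g (x + y)) + norm (g (x + (- t)) - g (x + (- y)))) / 2"
        unfolding eq using norm_triangle_ineq[of "g (x + t) - g (x + y)" "g (x + (- t)) - g (x + (- y))"]
        by (simp add: norm_divide)
    next
      show "integrable M (\<lambda>x. norm (cos_translate t g x - cos_translate y g x))"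
        using integrable_cos_translate[OF g] by (intro integrable_norm Bochner_Integration.integrable_diff)
      show "integrable M (\<lambda>x. (norm (g (x + t) - g (x + y)) + norm (g (x + (- t)) - g (x + (- y)))) / 2)"
        using i[of t] i[of y] i[of "- t"] i[of "- y"]
        by (intro integrable_divide Bochner_Integration.integrable_add integrable_norm Bochner_Integration.integrable_diff)
    qed
    also have "\<dots> = ((LINT x|M. norm (g (x + t) - g (x + y))) + (LINT x|M. norm (g (x + (- t)) - g (x + (- y))))) / 2"
      using i[of t] i[of y] i[of "- t"] i[of "- y"] by simp
    also have "\<dots> = ((LINT x|M. norm (g (x + (t - y)) - g x)) + (LINT x|M. norm (g (x + (- t - - y)) - g x))) / 2"
      unfolding shift ..
    also have "\<dots> < e"
      using U(3)[of "t - y"] U(3)[of "- t - - y"] ty by simp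
    finally show ?thesis .
  qed
  moreover have "open (U \<inter> uminus -` U)" "0 \<in> U \<inter> uminus -` U"
    using U by (auto intro!: open_Int open_vimage continuous_intros)
  ultimately show ?thesis using that by blast
qed

end

section \<open>Bounded functionals commute with the cosine convolution\<close>

locale L1_functional = haar_lca M for M :: "'a::{topological_ab_group_add,t2_space} measure" +
  fixes T :: "('a \<Rightarrow> complex) \<Rightarrow> complex" and C :: real
  assumes C_nonneg: "0 \<le> C"
    and T_add: "integrable M f \<Longrightarrow> integrable M g \<Longrightarrow> T (\<lambda>x. f x + g x) = T f + T g"
    and T_scale: "integrable M f \<Longrightarrow> T (\<lambda>x. c * f x) = c * T f"
    and T_bound: "integrable M f \<Longrightarrow> norm (T f) \<le> C * (LINT x|M. norm (f x))"
begin

lemma T_dist: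
  assumes "integrable M f" "integrable M g"
  shows "norm (T f - T g) \<le> C * (LINT x|M. norm (f x - g x))"
proof -
  have "T (\<lambda>x. f x + - 1 * g x) = T f + - 1 * T g"
    using assms by (subst T_add) (auto simp only: T_scale integrable_mult_right)
  then have "T (\<lambda>x. f x - g x) = T f - T g" by simp
  then show ?thesis using T_bound[of "\<lambda>x. f x - g x"] assms by simp
qed

lemma T_cong_AE:
  assumes "integrable M f" "integrable M g" "AE x in M. f x = g x"
  shows "T f = T g"
proof -
  have "(LINT x|M. norm (f x - g x)) = 0"
    using assms by (intro integral_eq_zero_AE) auto
  then show ?thesis using T_dist[OF assms(1,2)] by simp
qed

lemma T_zero: "T (\<lambda>_. 0) = 0"
  using T_bound[of "\<lambda>_. 0"] by simp

lemma continuous_T_cos_translate: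
  assumes g: "integrable M g"
  shows "continuous_on UNIV (\<lambda>y. T (cos_translate y g))"
  unfolding continuous_on_def
proof (intro ballI tendstoI)
  fix y :: 'a and e :: real assume e: "e > 0"
  have e': "e / (C + 1) > 0" using e C_nonneg by simp
  obtain U where U: "open U" "0 \<in> U"
    "\<And>t y. t - y \<in> U \<Longrightarrow> (LINT x|M. norm (cos_translate t g x - cos_translate y g x)) < e / (C + 1)"
    by (rule L1_cos_translate_uniformly_continuous[OF g e']) blast
  have "dist (T (cos_translate t g)) (T (cos_translate y g)) < e" if "t - y \<in> U" for t
  proof -
    let ?d = "LINT x|M. norm (cos_translate t g x - cos_translate y g x)"
    have "dist (T (cos_translate t g)) (T (cos_translate y g)) \<le> C * ?d"
      unfolding dist_norm by (intro T_dist integrable_cos_translate g)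
    also have "\<dots> \<le> (C + 1) * ?d" by (intro mult_right_mono) auto
    also have "\<dots> < e" using U(3)[OF that] C_nonneg by (simp add: field_simps)
    finally show ?thesis .
  qed
  moreover have "open ((\<lambda>t. t - y) -` U)" using U by (intro open_vimage continuous_intros)
  ultimately show "\<forall>\<^sub>F t in at y. dist (T (cos_translate t g)) (T (cos_translate y g)) < e"
    unfolding eventually_at_topological using U(2)
    by (intro exI[of _ "(\<lambda>t. t - y) -` U"]) auto
qed

lemma norm_T_cos_translate_le:
  assumes g: "integrable M g"
  shows "norm (T (cos_translate y g)) \<le> C * (LINT x|M. norm (g x))"
  using T_bound[OF integrable_cos_translate[OF g]] norm_cos_translate_le[OF g] C_nonneg
  by (meson mult_left_mono order_trans)

lemma integrable_mult_T_cos_translate: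
  assumes "integrable M f" and g: "integrable M g"
  shows "integrable M (\<lambda>y. f y * T (cos_translate y g))"
  using assms(1) borel_measurable_continuous_onI[OF continuous_T_cos_translate[OF g]]
    norm_T_cos_translate_le[OF g] by (rule integrable_mult_bounded)

end

locale L1_functional_subgroup = L1_functional M T C + haar_lca_subgroup M H
  for M :: "'a::{topological_ab_group_add,t2_space} measure" and T C H
begin

definition carried :: "('a \<Rightarrow> complex) \<Rightarrow> bool" where
  "carried f \<longleftrightarrow> integrable M f \<and> (\<forall>x. x \<notin> H \<longrightarrow> f x = 0)"

text \<open>
  The error in exchanging \<open>T\<close> with the integral over \<open>y\<close>. It is additive in \<open>f\<close> and
  bounded by the norm of \<open>f\<close>, and it will be shown to vanish by cutting \<open>f\<close> into pieces.
\<close>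

definition defect :: "('a \<Rightarrow> complex) \<Rightarrow> ('a \<Rightarrow> complex) \<Rightarrow> complex" where
  "defect g f = T (cos_conv M f g) - (LINT y|M. f y * T (cos_translate y g))"

lemma AE_N_imp_M: "AE x in N. P x \<Longrightarrow> AE x in M. x \<in> H \<longrightarrow> P x"
  unfolding N_def by (subst (asm) AE_density) (auto simp: indicator_def elim!: eventually_mono)

lemma cos_conv_section_AE:
  assumes g: "adapted g" and f: "carried f"
  shows "AE x in N. integrable N (\<lambda>y. f y * cos_kernel g (x, y))"
proof -
  have f': "integrable M f" "\<forall>x. x \<notin> H \<longrightarrow> f x = 0" using f by (auto simp: carried_def)
  from NN.AE_integrable_fst'[OF cos_kernel_integrable(1)[OF g f']] show ?thesis by simp
qed

text \<open>
  Additivity can fail at points where one of the defining integrals diverges; by Fubini's theorem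
  these form a null set.
\<close>

lemma cos_conv_add_AE:
  assumes g: "adapted g" and f: "carried f" and k: "carried k"
  shows "AE x in M. cos_conv M (\<lambda>y. f y + k y) g x = cos_conv M f g x + cos_conv M k g x"
proof -
  have f': "integrable M f" "\<forall>x. x \<notin> H \<longrightarrow> f x = 0" and k': "integrable M k" "\<forall>x. x \<notin> H \<longrightarrow> k x = 0"
    using f k by (auto simp: carried_def)
  have fk': "integrable M (\<lambda>y. f y + k y)" "\<forall>x. x \<notin> H \<longrightarrow> f x + k x = 0" using f' k' by auto
  have "AE x in N. cos_conv M (\<lambda>y. f y + k y) g x = cos_conv M f g x + cos_conv M k g x"
    using cos_conv_section_AE[OF g f] cos_conv_section_AE[OF g k]
  proof eventually_elim
    case (elim x)
    then show ?case
      by (simp add: cos_conv_eq_kernel[OF g f'] cos_conv_eq_kernel[OF g k'] cos_conv_eq_kernel[OF g fk'] distrib_right)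
  qed
  from AE_N_imp_M[OF this] show ?thesis
  proof eventually_elim
    case (elim x)
    then show ?case
      using cos_conv_outside[OF g f', of x] cos_conv_outside[OF g k', of x] cos_conv_outside[OF g fk', of x]
      by (cases "x \<in> H") auto
  qed
qed

lemma defect_add:
  assumes g: "adapted g" and f: "carried f" and k: "carried k"
  shows "defect g (\<lambda>y. f y + k y) = defect g f + defect g k"
proof -
  have i: "integrable M f" "integrable M k" "integrable M g"
    using f k adaptedD(1)[OF g] by (auto simp: carried_def)
  have "T (cos_conv M (\<lambda>y. f y + k y) g) = T (\<lambda>x. cos_conv M f g x + cos_conv M k g x)"
    using i by (intro T_cong_AE cos_conv_add_AE[OF g f k] Bochner_Integration.integrable_add cos_conv_integrable)
  also have "\<dots> = T (cos_conv M f g) + T (cos_conv M k g)"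
    using i by (intro T_add cos_conv_integrable)
  moreover have "(LINT y|M. (f y + k y) * T (cos_translate y g))
      = (LINT y|M. f y * T (cos_translate y g)) + (LINT y|M. k y * T (cos_translate y g))"
    using integrable_mult_T_cos_translate[OF i(1,3)] integrable_mult_T_cos_translate[OF i(2,3)]
    by (simp add: distrib_right)
  ultimately show ?thesis by (simp add: defect_def)
qed

lemma carried_indicator:
  assumes "carried f" and "A \<in> sets borel"
  shows "carried (\<lambda>y. indicator A y * f y)"
proof -
  have "integrable M (\<lambda>y. indicator A y *\<^sub>R f y)"
    using assms by (intro integrable_mult_indicator) (auto simp: carried_def sets_M)
  moreover have "(\<lambda>y. indicator A y *\<^sub>R f y) = (\<lambda>y. indicator A y * f y)"
    by (auto simp: indicator_def)
  ultimately show ?thesis using assms(1) by (simp add: carried_def)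
qed

text \<open>
  If \<open>f\<close> lives where \<open>\<tau>\<^sub>y g\<close> is within \<open>e\<close> of \<open>\<tau>\<^sub>a g\<close>, then both terms of the defect
  are within \<open>C * e * \<integral> \<bar>f\<bar>\<close> of \<open>(\<integral> f) * T (\<tau>\<^sub>a g)\<close>: for the first this is Fubini's theorem
  applied to the kernel \<open>\<tau>\<^sub>y g x - \<tau>\<^sub>a g x\<close>.
\<close>

lemma defect_small_support:
  assumes g: "adapted g" and f: "carried f" and a: "a \<in> H"
    and e: "\<And>y. f y \<noteq> 0 \<Longrightarrow> (LINT x|M. norm (cos_translate y g x - cos_translate a g x)) \<le> e"
  shows "norm (defect g f) \<le> 2 * C * e * (LINT y|M. norm (f y))"
proof -
  have fi: "integrable M f" and f0: "\<forall>x. x \<notin> H \<longrightarrow> f x = 0" using f by (auto simp: carried_def)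
  have gi: "integrable M g" using adaptedD(1)[OF g] .
  note ti = integrable_cos_translate[OF gi]
  let ?I = "LINT y|M. f y"
  let ?R = "\<lambda>x. ?I * cos_translate a g x"
  have tb: "cos_translate y g \<in> borel_measurable borel" for y by (rule integrable_borel[OF ti])
  define k where "k = (\<lambda>p. cos_kernel g p - cos_translate a g (fst p))"
  have kb: "k \<in> borel_measurable (borel \<Otimes>\<^sub>M borel)"
    unfolding k_def using cos_kernel_borel[OF g] tb[of a] by measurable
  have k_eq: "k (x, y) = cos_translate y g x - cos_translate a g x" if "y \<in> H" for x y
    using that by (simp add: k_def cos_kernel_def)
  have ki: "integrable N (\<lambda>x. k (x, y))" if "y \<in> H" for y
    unfolding k_eq[OF that] using cos_translate_outside[OF g] that a ti
    by (intro integrable_N Bochner_Integration.integrable_diff) auto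
  have kn: "(LINT x|N. norm (k (x, y))) \<le> e" if y: "y \<in> H" "f y \<noteq> 0" for y
  proof -
    have "(LINT x|N. norm (k (x, y))) = (LINT x|M. norm (cos_translate y g x - cos_translate a g x))"
      unfolding k_eq[OF y(1)] using cos_translate_outside[OF g] y a tb by (intro integral_N) auto
    then show ?thesis using e[OF y(2)] by simp
  qed
  have fN: "(LINT y|N. norm (f y)) = (LINT y|M. norm (f y))" "(LINT y|N. f y) = ?I"
    using f0 integrable_borel[OF fi] by (auto intro!: integral_N)
  note K = kernel_integrable[OF kb integrable_N[OF fi f0] ki kn]
  have "AE x in N. (LINT y|N. f y * k (x, y)) = cos_conv M f g x - ?R x"
    using cos_conv_section_AE[OF g f]
  proof eventually_elim
    case (elim x)
    have "(LINT y|N. f y * k (x, y)) = (LINT y|N. f y * cos_kernel g (x, y) - f y * cos_translate a g x)"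
      by (simp add: k_def right_diff_distrib)
    also have "\<dots> = (LINT y|N. f y * cos_kernel g (x, y)) - (LINT y|N. f y * cos_translate a g x)"
      using elim integrable_N[OF fi f0] by (intro Bochner_Integration.integral_diff) auto
    finally show ?case by (simp add: cos_conv_eq_kernel[OF g fi f0] fN(2))
  qed
  moreover have ci: "integrable M (cos_conv M f g)" by (rule cos_conv_integrable[OF fi gi])
  note cb = integrable_borel[OF ci]
  have Rout: "x \<notin> H \<Longrightarrow> ?R x = 0" for x using cos_translate_outside[OF g a] by simp
  ultimately have "(LINT x|N. norm (cos_conv M f g x - ?R x)) = (LINT x|N. norm (LINT y|N. f y * k (x, y)))"
    using cb tb[of a] borel_measurable_integrable[OF NN.integrable_fst'[OF K(1)]]
    by (intro integral_cong_AE) (auto simp: measurable_cong_sets[OF sets_N])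
  then have 1: "(LINT x|M. norm (cos_conv M f g x - ?R x)) \<le> e * (LINT y|M. norm (f y))"
    using K(2) cb tb[of a] cos_conv_outside[OF g fi f0] Rout
    by (subst integral_N[symmetric]) (auto simp: fN)
  have "norm (T (cos_conv M f g) - T ?R) \<le> C * (e * (LINT y|M. norm (f y)))"
    by (rule order_trans[OF T_dist[OF ci integrable_mult_right[OF ti]] mult_left_mono[OF 1 C_nonneg]])
  moreover have "T ?R = ?I * T (cos_translate a g)" using T_scale[OF ti] .
  moreover have "norm (?I * T (cos_translate a g) - (LINT y|M. f y * T (cos_translate y g))) \<le> C * (e * (LINT y|M. norm (f y)))"
  proof -
    note fT = integrable_mult_T_cos_translate[OF fi gi]
    have fTa: "integrable M (\<lambda>y. f y * T (cos_translate a g))" using fi by auto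
    have "?I * T (cos_translate a g) - (LINT y|M. f y * T (cos_translate y g))
        = (LINT y|M. f y * T (cos_translate a g) - f y * T (cos_translate y g))"
      using fT fTa by simp
    also have "norm \<dots> \<le> (LINT y|M. norm (f y * T (cos_translate a g) - f y * T (cos_translate y g)))"
      by (rule integral_norm_bound)
    also have "\<dots> \<le> (LINT y|M. (C * e) * norm (f y))"
    proof (rule integral_mono)
      fix y
      show "norm (f y * T (cos_translate a g) - f y * T (cos_translate y g)) \<le> (C * e) * norm (f y)"
      proof (cases "f y = 0")
        case False
        have "norm (T (cos_translate y g) - T (cos_translate a g)) \<le> C * e"
          using T_dist[OF ti ti] e[OF False] C_nonneg by (meson mult_left_mono order_trans)
        then have "norm (f y) * norm (T (cos_translate a g) - T (cos_translate y g)) \<le> norm (f y) * (C * e)"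
          by (intro mult_left_mono) (simp_all add: norm_minus_commute)
        then show ?thesis by (simp add: mult.commute flip: right_diff_distrib norm_mult)
      qed simp
    qed (use fT fTa fi in auto)
    finally show ?thesis by (simp add: mult.assoc)
  qed
  ultimately show ?thesis
    unfolding defect_def using norm_triangle_ineq[of "T (cos_conv M f g) - T ?R" "T ?R - (LINT y|M. f y * T (cos_translate y g))"]
    by simp
qed

lemma defect_zero: "defect g (\<lambda>_. 0) = 0"
proof -
  have "cos_conv M (\<lambda>_. 0) g = (\<lambda>_. 0)" by (simp add: cos_conv_def fun_eq_iff)
  then show ?thesis by (simp add: defect_def T_zero)
qed

text \<open>
  The bound of \<open>defect_small_support\<close> adds up without loss over pieces with disjoint supports, so
  its constant does not depend on the number of pieces.
\<close>

lemma defect_finite_cover: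
  assumes g: "adapted g" and F: "finite F" "F \<subseteq> H" and U: "open U"
    and e: "\<And>t y. t - y \<in> U \<Longrightarrow> (LINT x|M. norm (cos_translate t g x - cos_translate y g x)) \<le> e"
    and f: "carried f" "\<And>y. f y \<noteq> 0 \<Longrightarrow> \<exists>a\<in>F. y - a \<in> U"
  shows "norm (defect g f) \<le> 2 * C * e * (LINT y|M. norm (f y))"
  using F f
proof (induction F arbitrary: f)
  case empty
  then have "f = (\<lambda>_. 0)" by auto
  then show ?case by (simp add: defect_zero)
next
  case (insert a F)
  define A where "A = (\<lambda>y. y - a) -` U"
  have A: "A \<in> sets borel" "- A \<in> sets borel"
    unfolding A_def using U by (auto intro!: borel_open open_vimage continuous_intros borel_comp)
  define f1 f2 where "f1 = (\<lambda>y. indicator A y * f y)" and "f2 = (\<lambda>y. indicator (- A) y * f y)"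
  have c: "carried f1" "carried f2"
    unfolding f1_def f2_def using insert.prems(2) A by (auto intro: carried_indicator)
  then have ci: "integrable M f1" "integrable M f2" by (auto simp: carried_def)
  have f_eq: "f = (\<lambda>y. f1 y + f2 y)" by (auto simp: f1_def f2_def indicator_def)
  have "norm (defect g f1) \<le> 2 * C * e * (LINT y|M. norm (f1 y))"
    using insert.prems(1) e by (intro defect_small_support[OF g c(1), of a]) (auto simp: f1_def A_def indicator_def)
  moreover have "norm (defect g f2) \<le> 2 * C * e * (LINT y|M. norm (f2 y))"
    using insert.prems by (intro insert.IH c(2)) (auto simp: f2_def A_def indicator_def split: if_splits)
  moreover have "(LINT y|M. norm (f y)) = (LINT y|M. norm (f1 y) + norm (f2 y))"
    by (intro Bochner_Integration.integral_cong) (auto simp: f1_def f2_def indicator_def)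
  then have "(LINT y|M. norm (f y)) = (LINT y|M. norm (f1 y)) + (LINT y|M. norm (f2 y))"
    using ci by simp
  moreover have "norm (defect g f) \<le> norm (defect g f1) + norm (defect g f2)"
    unfolding f_eq defect_add[OF g c] by (rule norm_triangle_ineq)
  ultimately show ?case by (simp add: algebra_simps)
qed

lemma defect_compact_support:
  assumes g: "adapted g" and f: "carried f" and K: "compact K" "K \<subseteq> H" "\<And>y. y \<notin> K \<Longrightarrow> f y = 0"
  shows "defect g f = 0"
proof -
  let ?c = "2 * C * (LINT y|M. norm (f y))"
  have c0: "0 \<le> ?c" using C_nonneg by simp
  have bound: "norm (defect g f) \<le> ?c * e" if e: "e > 0" for e
  proof -
    obtain U where U: "open U" "0 \<in> U"
      "\<And>t y. t - y \<in> U \<Longrightarrow> (LINT x|M. norm (cos_translate t g x - cos_translate y g x)) < e"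
      by (rule L1_cos_translate_uniformly_continuous[OF adaptedD(1)[OF g] e]) blast
    have oU: "open ((\<lambda>y. y - a) -` U)" for a
      using U(1) by (intro open_vimage continuous_intros)
    have "K \<subseteq> (\<Union>a\<in>K. (\<lambda>y. y - a) -` U)" using U(2) by force
    then obtain F where F: "F \<subseteq> K" "finite F" "K \<subseteq> (\<Union>a\<in>F. (\<lambda>y. y - a) -` U)"
      using compactE_image[OF K(1), of K "\<lambda>a. (\<lambda>y. y - a) -` U"] oU by metis
    have cov: "\<exists>a\<in>F. y - a \<in> U" if "f y \<noteq> 0" for y
      using that K(3)[of y] F(3) by blast
    have "norm (defect g f) \<le> 2 * C * e * (LINT y|M. norm (f y))"
      using F K(2) U(3) cov by (intro defect_finite_cover[OF g _ _ U(1) _ f, of F]) (auto intro: less_imp_le)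
    then show ?thesis by (simp add: mult_ac)
  qed
  have "norm (defect g f) \<le> 0 + d" if d: "d > 0" for d
  proof -
    have "norm (defect g f) \<le> ?c * (d / (?c + 1))"
      using d c0 by (intro bound) simp
    also have "\<dots> \<le> d" using d c0 by (simp add: field_simps)
    finally show ?thesis by simp
  qed
  then have "norm (defect g f) \<le> 0" by (rule field_le_epsilon)
  then show ?thesis by simp
qed

lemma norm_defect_le:
  assumes g: "adapted g" and f: "carried f"
  shows "norm (defect g f) \<le> 2 * C * (LINT x|M. norm (g x)) * (LINT y|M. norm (f y))"
proof -
  let ?G = "LINT x|M. norm (g x)"
  have fi: "integrable M f" and f0: "\<forall>x. x \<notin> H \<longrightarrow> f x = 0" using f by (auto simp: carried_def)
  have gi: "integrable M g" using adaptedD(1)[OF g] .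
  note fT = integrable_mult_T_cos_translate[OF fi gi]
  have ci: "integrable M (cos_conv M f g)" by (rule cos_conv_integrable[OF fi gi])
  have "(LINT x|M. norm (cos_conv M f g x)) = (LINT x|N. norm (cos_conv M f g x))"
    using cos_conv_outside[OF g fi f0] integrable_borel[OF ci] by (intro integral_N[symmetric]) auto
  also have "\<dots> = (LINT x|N. norm (LINT y|N. f y * cos_kernel g (x, y)))"
    unfolding cos_conv_eq_kernel[OF g fi f0] ..
  also have "\<dots> \<le> ?G * (LINT y|N. norm (f y))"
    by (rule cos_kernel_integrable(2)[OF g fi f0])
  also have "(LINT y|N. norm (f y)) = (LINT y|M. norm (f y))"
    using f0 integrable_borel[OF fi] by (auto intro!: integral_N)
  finally have "norm (T (cos_conv M f g)) \<le> C * (?G * (LINT y|M. norm (f y)))"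
    using T_bound[OF ci] C_nonneg by (meson mult_left_mono order_trans)
  moreover have "norm (LINT y|M. f y * T (cos_translate y g)) \<le> C * ?G * (LINT y|M. norm (f y))"
  proof -
    have "norm (LINT y|M. f y * T (cos_translate y g)) \<le> (LINT y|M. norm (f y * T (cos_translate y g)))"
      by (rule integral_norm_bound)
    also have "\<dots> \<le> (LINT y|M. (C * ?G) * norm (f y))"
    proof (rule integral_mono)
      show "norm (f y * T (cos_translate y g)) \<le> (C * ?G) * norm (f y)" for y
        using mult_left_mono[OF norm_T_cos_translate_le[OF gi, of y] norm_ge_zero[of "f y"]]
        by (simp add: norm_mult mult_ac)
    qed (use fT fi in auto)
    finally show ?thesis by simp
  qed
  ultimately show ?thesis
    unfolding defect_def using norm_triangle_ineq4[of "T (cos_conv M f g)" "LINT y|M. f y * T (cos_translate y g)"]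
    by (simp add: mult.assoc)
qed

lemma defect_eq_zero:
  assumes g: "adapted g" and f: "carried f"
  shows "defect g f = 0"
proof -
  have fi: "integrable M f" and f0: "\<forall>x. x \<notin> H \<longrightarrow> f x = 0" using f by (auto simp: carried_def)
  obtain B :: "nat \<Rightarrow> 'a set" where B: "\<And>n. compact (B n)" "incseq B" "H = (\<Union>n. B n)"
    using H_exhaustion by blast
  have Bb: "B n \<in> sets borel" "- B n \<in> sets borel" for n
    using compact_imp_closed[OF B(1)] by (auto intro: borel_closed borel_comp)
  let ?r = "\<lambda>n y. indicator (- B n) y * f y"
  have c: "carried (\<lambda>y. indicator (B n) y * f y)" "carried (?r n)" for n
    using carried_indicator[OF f] Bb by auto
  have le: "norm (defect g f) \<le> 2 * C * (LINT x|M. norm (g x)) * (LINT y|M. norm (?r n y))" for n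
  proof -
    have "(\<lambda>y. indicator (B n) y * f y + ?r n y) = f" by (auto simp: indicator_def)
    then have "defect g f = defect g (\<lambda>y. indicator (B n) y * f y) + defect g (?r n)"
      using defect_add[OF g c(1)[of n] c(2)[of n]] by (simp only:)
    moreover have "defect g (\<lambda>y. indicator (B n) y * f y) = 0"
      using B by (intro defect_compact_support[OF g c(1) B(1)[of n]]) auto
    ultimately show ?thesis using norm_defect_le[OF g c(2)] by simp
  qed
  have "(\<lambda>n. LINT y|M. norm (?r n y)) \<longlonglongrightarrow> (LINT y|M. 0)"
  proof (rule integral_dominated_convergence[where w="\<lambda>y. norm (f y)"])
    show "AE y in M. (\<lambda>n. norm (?r n y)) \<longlonglongrightarrow> 0"
    proof (rule AE_I2)
      fix y
      show "(\<lambda>n. norm (?r n y)) \<longlonglongrightarrow> 0"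
      proof (cases "y \<in> H")
        case True
        then obtain m where m: "y \<in> B m" using B(3) by blast
        have "y \<in> B n" if "m \<le> n" for n using incseqD[OF B(2) that] m by blast
        then have "eventually (\<lambda>n. norm (?r n y) = 0) sequentially"
          by (intro eventually_sequentiallyI[of m]) auto
        then show ?thesis by (rule tendsto_eventually)
      qed (use f0 in auto)
    qed
    show "AE y in M. norm (norm (?r n y)) \<le> norm (f y)" for n
      by (intro AE_I2) (auto simp: indicator_def)
    show "(\<lambda>y. norm (?r n y)) \<in> borel_measurable M" for n
      using c(2)[of n] by (auto simp: carried_def)
  qed (use fi in auto)
  then have "(\<lambda>n. 2 * C * (LINT x|M. norm (g x)) * (LINT y|M. norm (?r n y))) \<longlonglongrightarrow> 2 * C * (LINT x|M. norm (g x)) * 0"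
    by (intro tendsto_mult tendsto_const) simp
  then have "norm (defect g f) \<le> 2 * C * (LINT x|M. norm (g x)) * 0"
    using le by (intro LIMSEQ_le_const) auto
  then show ?thesis by simp
qed

end

context L1_functional
begin

text \<open>
  The vector-valued integral formula for the convolution, tested against one functional.
\<close>

lemma T_cos_conv:
  assumes f: "integrable M f" and g: "integrable M g"
  shows "T (cos_conv M f g) = (LINT y|M. f y * T (cos_translate y g))"
proof -
  obtain H f' g' where HK: "haar_lca_subgroup M H"
    "haar_lca_subgroup.adapted M H f'" "AE x in M. f x = f' x"
    "haar_lca_subgroup.adapted M H g'" "AE x in M. g x = g' x"
    using adapted_representatives[OF f g] .
  interpret haar_lca_subgroup M H by (fact HK(1))
  interpret L1_functional_subgroup M T C H ..
  note f' = adaptedD(1)[OF HK(2)] and g' = adaptedD(1)[OF HK(4)]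
  have "carried f'" using f' adaptedD(2)[OF HK(2)] by (simp add: carried_def)
  then have "T (cos_conv M f' g') = (LINT y|M. f' y * T (cos_translate y g'))"
    using defect_eq_zero[OF HK(4)] by (simp add: defect_def)
  moreover have "cos_conv M f g = cos_conv M f' g'"
    using HK f g f' g' by (intro cos_conv_cong_AE) auto
  moreover have "T (cos_translate y g) = T (cos_translate y g')" for y
  proof (intro T_cong_AE integrable_cos_translate g g')
    show "AE x in M. cos_translate y g x = cos_translate y g' x"
      using AE_translate[OF HK(5), of y] AE_translate[OF HK(5), of "- y"]
      by eventually_elim (simp add: cos_translate_def)
  qed
  moreover have "(LINT y|M. f y * T (cos_translate y g')) = (LINT y|M. f' y * T (cos_translate y g'))"
    using HK(3) integrable_mult_T_cos_translate[OF f g'] integrable_mult_T_cos_translate[OF f' g']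
    by (intro integral_cong_AE) auto
  ultimately show ?thesis by simp
qed

text \<open>
  The formula for \<open>T (f \<star> g)\<close> is used twice: with the fixed \<open>g\<close> it gives the density
  \<open>\<phi>\<close>, and with an arbitrary second factor it makes every \<open>f\<close> an eigenvector of the cosine
  translations modulo the kernel of \<open>T\<close>. The eigenvalues inherit the composition law of these
  translations.
\<close>

lemma COS_representation:
  assumes mult: "\<And>f g. integrable M f \<Longrightarrow> integrable M g \<Longrightarrow> T (cos_conv M f g) = T f * T g"
    and g: "integrable M g" "T g \<noteq> 0"
  shows "\<exists>\<phi>\<in>COS. \<forall>f. integrable M f \<longrightarrow> T f = (LINT x|M. f x * \<phi> x)"
proof -
  define \<phi> where "\<phi> = (\<lambda>y. T (cos_translate y g) / T g)"
  have c: "continuous_on UNIV \<phi>"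
    unfolding \<phi>_def using continuous_T_cos_translate[OF g(1)] g(2) by (intro continuous_intros) auto
  have "norm (\<phi> y) \<le> C * (LINT x|M. norm (g x)) / norm (T g)" for y
    unfolding \<phi>_def norm_divide using norm_T_cos_translate_le[OF g(1)] g(2) by (intro divide_right_mono) auto
  then have b: "bounded (range \<phi>)" unfolding bounded_iff by blast
  have rep: "T f = (LINT x|M. f x * \<phi> x)" if f: "integrable M f" for f
  proof -
    have "T f * T g = (LINT y|M. f y * T (cos_translate y g))"
      using mult[OF f g(1)] T_cos_conv[OF f g(1)] by simp
    then have "T f = (LINT y|M. f y * T (cos_translate y g)) / T g" using g(2) by (simp add: field_simps)
    then show ?thesis by (simp add: \<phi>_def)
  qed
  have eigen: "T (cos_translate y f) = \<phi> y * T f" if f: "integrable M f" for f y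
  proof -
    have "T (cos_translate y f) - \<phi> y * T f = 0"
    proof (rule continuous_eq_zero_if_annihilates_L1)
      show "continuous_on UNIV (\<lambda>y. T (cos_translate y f) - \<phi> y * T f)"
        using continuous_T_cos_translate[OF f] c by (intro continuous_intros)
      fix h :: "'a \<Rightarrow> complex" assume h: "integrable M h"
      have i1: "integrable M (\<lambda>x. h x * T (cos_translate x f))"
        by (rule integrable_mult_T_cos_translate[OF h f])
      have "integrable M (\<lambda>x. h x * \<phi> x)"
        using integrable_mult_T_cos_translate[OF h g(1)] by (simp add: \<phi>_def)
      then have i2: "integrable M (\<lambda>x. h x * \<phi> x * T f)" by simp
      have "(LINT x|M. h x * (T (cos_translate x f) - \<phi> x * T f))
          = (LINT x|M. h x * T (cos_translate x f)) - (LINT x|M. h x * \<phi> x * T f)"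
        using i1 i2 by (simp add: right_diff_distrib mult.assoc)
      also have "\<dots> = T (cos_conv M h f) - T h * T f"
        using T_cos_conv[OF h f] rep[OF h] by simp
      finally show "(LINT x|M. h x * (T (cos_translate x f) - \<phi> x * T f)) = 0"
        using mult[OF h f] by simp
    qed
    then show ?thesis by simp
  qed
  have "\<phi> x * \<phi> y = (\<phi> (x + y) + \<phi> (x - y)) / 2" for x y
  proof -
    note i = integrable_cos_translate[OF g(1)]
    have "cos_translate x (cos_translate y g) = (\<lambda>t. (1/2) * (cos_translate (x + y) g t + cos_translate (x - y) g t))"
      by (auto simp: cos_translate_def fun_eq_iff algebra_simps add_divide_distrib)
    then have "T (cos_translate x (cos_translate y g)) = (1/2) * (T (cos_translate (x + y) g) + T (cos_translate (x - y) g))"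
      using i by (simp only: T_scale T_add Bochner_Integration.integrable_add)
    then have "\<phi> x * \<phi> y * T g = (\<phi> (x + y) + \<phi> (x - y)) / 2 * T g"
      using i g by (simp add: eigen algebra_simps add_divide_distrib)
    then show ?thesis using g(2) by (metis mult_cancel_right)
  qed
  moreover have "\<phi> \<noteq> (\<lambda>_. 0)"
  proof
    assume "\<phi> = (\<lambda>_. 0)"
    with rep[OF g(1)] have "T g = 0" by (simp only: mult_zero_right integral_zero)
    with g(2) show False by simp
  qed
  ultimately have "\<phi> \<in> COS" unfolding COS_def bcontfun_def using c b by blast
  then show ?thesis using rep by (intro bexI[of _ \<phi>]) auto
qed

end

context haar_lca
begin

section \<open>The characters of the cosine convolution\<close>

text \<open>
  Continuity at \<open>0\<close> and homogeneity give a bound on the norm. The case of a function with norm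
  \<open>0\<close> is included by rescaling with a number slightly larger than the norm.
\<close>

lemma Delta_imp_L1_functional:
  assumes m: "m \<in> Delta M"
  obtains C where "L1_functional M (\<lambda>f. m (L1_class M f)) C"
proof -
  let ?T = "\<lambda>f. m (L1_class M f)"
  have add: "?T (\<lambda>x. f x + g x) = ?T f + ?T g" if "integrable M f" "integrable M g" for f g
    using m that by (simp add: Delta_def)
  have scale: "?T (\<lambda>x. c * f x) = c * ?T f" if "integrable M f" for c f
    using m that by (simp add: Delta_def)
  have cont: "\<forall>f. integrable M f \<longrightarrow> (\<forall>e>0. \<exists>d>0. \<forall>g. integrable M g \<longrightarrow>
      (LINT x|M. norm (g x - f x)) < d \<longrightarrow> dist (?T g) (?T f) < e)"
    using m by (simp add: Delta_def)
  have T0: "?T (\<lambda>_. 0) = 0" using scale[of "\<lambda>_. 0" 0] by simp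
  obtain d where d: "d > 0" "\<And>g. integrable M g \<Longrightarrow> (LINT x|M. norm (g x)) < d \<Longrightarrow> norm (?T g) < 1"
    using cont[rule_format, of "\<lambda>_. 0" 1] T0 by auto
  have bound: "norm (?T f) \<le> 1 / d * (LINT x|M. norm (f x))" if f: "integrable M f" for f
  proof -
    let ?n = "LINT x|M. norm (f x)"
    have n0: "0 \<le> ?n" by simp
    have "norm (?T f) \<le> 1 / d * ?n + e" if e: "e > 0" for e
    proof -
      define s where "s = ?n + d * e"
      have s: "s > ?n" "s > 0" using n0 d(1) e by (auto simp: s_def add_nonneg_pos)
      have "(LINT x|M. norm (complex_of_real (d / s) * f x)) = d / s * ?n"
        using d(1) s(2) by (simp add: norm_mult norm_divide)
      also have "\<dots> < d" using s d(1) by (simp add: field_simps)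
      finally have "norm (?T (\<lambda>x. complex_of_real (d / s) * f x)) < 1"
        using f by (intro d(2)) auto
      then have "d / s * norm (?T f) < 1"
        using d(1) s(2) scale[OF f, of "complex_of_real (d / s)"] by (simp add: norm_mult norm_divide)
      then have "norm (?T f) < s / d" using d(1) s(2) by (simp add: field_simps)
      also have "s / d = 1 / d * ?n + e" using d(1) by (simp add: s_def field_simps)
      finally show ?thesis by simp
    qed
    then show ?thesis by (rule field_le_epsilon)
  qed
  have "L1_functional M ?T (1 / d)"
  proof (intro L1_functional.intro L1_functional_axioms.intro haar_lca_axioms)
    show "0 \<le> 1 / d" using d(1) by simp
  qed (use add scale bound in auto)
  then show ?thesis using that by blast
qed

lemma m_fun_inj:
  assumes "\<phi> \<in> COS" "\<psi> \<in> COS" "m_fun M \<phi> = m_fun M \<psi>"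
  shows "\<phi> = \<psi>"
proof
  fix x
  obtain C where C: "\<And>x. norm (\<phi> x) \<le> C" using COS_D(3)[OF assms(1)] by blast
  obtain D where D: "\<And>x. norm (\<psi> x) \<le> D" using COS_D(3)[OF assms(2)] by blast
  have "\<phi> x - \<psi> x = 0"
  proof (rule continuous_eq_zero_if_annihilates_L1)
    show "continuous_on UNIV (\<lambda>x. \<phi> x - \<psi> x)"
      using assms(1,2) by (intro continuous_intros COS_D)
    fix f :: "'a \<Rightarrow> complex" assume f: "integrable M f"
    have "(LINT x|M. f x * \<phi> x) = (LINT x|M. f x * \<psi> x)"
      using assms m_fun_L1_class[OF haar _ f] by metis
    then show "(LINT x|M. f x * (\<phi> x - \<psi> x)) = 0"
      using integrable_mult_bounded[OF f COS_D(2)[OF assms(1)] C]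
        integrable_mult_bounded[OF f COS_D(2)[OF assms(2)] D] by (simp add: right_diff_distrib)
  qed
  then show "\<phi> x = \<psi> x" by simp
qed

lemma Delta_representation:
  assumes m: "m \<in> Delta M"
  shows "\<exists>\<phi>. \<phi> \<in> COS \<and> m = m_fun M \<phi>"
proof -
  obtain C where "L1_functional M (\<lambda>f. m (L1_class M f)) C"
    using Delta_imp_L1_functional[OF m] .
  then interpret L1_functional M "\<lambda>f. m (L1_class M f)" C .
  have mult: "m (L1_class M (cos_conv M f g)) = m (L1_class M f) * m (L1_class M g)"
    if "integrable M f" "integrable M g" for f g
    using m that by (simp add: Delta_def)
  have "\<exists>F\<in>L1 M. m F \<noteq> 0" using m by (simp add: Delta_def)
  then obtain F where F: "F \<in> L1 M" "m F \<noteq> 0" by (elim bexE)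
  obtain g where g: "integrable M g" "F = L1_class M g" by (rule L1_E[OF F(1)])
  obtain \<phi> where \<phi>: "\<phi> \<in> COS" "\<And>f. integrable M f \<Longrightarrow> m (L1_class M f) = (LINT x|M. f x * \<phi> x)"
    using COS_representation[OF mult g(1)] F(2) by (auto simp: g(2))
  have "m = m_fun M \<phi>"
  proof (rule extensionalityI)
    show "m \<in> extensional (L1 M)" using m by (simp add: Delta_def)
    show "m_fun M \<phi> \<in> extensional (L1 M)" by (simp add: m_fun_def)
    fix F assume "F \<in> L1 M"
    then obtain f where "integrable M f" "F = L1_class M f" by (rule L1_E)
    then show "m F = m_fun M \<phi> F" using \<phi> m_fun_L1_class[OF haar \<phi>(1)] by simp
  qed
  then show ?thesis using \<phi>(1) by blast
qed

end

theorem theorem4: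
  fixes M :: "'a::{topological_ab_group_add,t2_space} measure"
  assumes "locally_compact_space (euclidean :: 'a topology)"
    and "haar_measure M"
  shows "(\<forall>\<phi>\<in>COS. m_fun M \<phi> \<in> Delta M) \<and>
         (\<forall>m\<in>Delta M. \<exists>!\<phi>. \<phi> \<in> COS \<and> m = m_fun M \<phi>)"
proof -
  interpret haar_lca M
    using assms by unfold_locales
  show ?thesis
  proof (intro conjI ballI)
    fix m assume "m \<in> Delta M"
    then obtain \<phi> where \<phi>: "\<phi> \<in> COS" "m = m_fun M \<phi>"
      using Delta_representation by blast
    show "\<exists>!\<phi>. \<phi> \<in> COS \<and> m = m_fun M \<phi>"
      using \<phi> m_fun_inj by (intro ex1I[of _ \<phi>]) auto
  qed (rule m_fun_COS_in_Delta)
qed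

end
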